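(* Let $m\ge 2$, $n=2^m-1$, let $h_2(X)\in\mathbb{Z}_2[X]$ be a primitive irreducible polynomial of degree $m$, and let $h(X)\in\mathbb{Z}_4[X]$ be the unique monic polynomial of degree $m$ such that $h(X)\equiv h_2(X)\pmod 2$ and $h(X)$ divides $X^n-1$ in $\mathbb{Z}_4[X]$. Let $g(X)$ be the reciprocal polynomial to $(X^n-1)/((X-1)h(X))$, and let $D$ be the quaternary code of length $2^m$ obtained by extending the cyclic code over $\mathbb{Z}_4$ of length $n$ generated by $g(X)$ by an overall parity check. Then the cyclic code over $\mathbb{Z}_4$ of length $n$ generated by $h(X)$, extended by an overall parity check, is the quaternary code $D^\perp$ dual to $D$. Moreover, for $m$ odd, $m\ge 3$, the corresponding binary code $P=\phi(D^\perp)$ has length $2^{m+1}$, contains $2^k$ words with $k=2^{m+1}-2m-2$, has minimal distance $6$, and has the same weight enumerator as the Preparata code of length $2^{m+1}$.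
   Context: Cyclic codes: the cyclic code of length $n$ over $\mathbb{Z}_4$ generated by a polynomial $f(X)$ is the set of coefficient vectors $(c_0,\dots,c_{n-1})$ of elements of the ideal generated by $f(X)$ in $\mathbb{Z}_4[X]/(X^n-1)$. Extending by an overall parity check means appending to each codeword a coordinate $c_\infty=-\sum_i c_i$ (in the same position for all codes). The reciprocal polynomial to a polynomial $f$ of degree $d$ is $X^d f(1/X)$. "Primitive" means that a root of $h_2$ generates the multiplicative group of $\mathbb{F}_{2^m}$. The dual of $D\subseteq\mathbb{Z}_4^N$ is $D^\perp=\{b\in\mathbb{Z}_4^N:\sum_i a_ib_i\equiv 0\pmod 4\ \forall a\in D\}$. Binary image: define $\beta,\gamma:\mathbb{Z}_4\to\mathbb{Z}_2$ by $\beta(0),\beta(1),\beta(2),\beta(3)=0,0,1,1$ and $\gamma(0),\gamma(1),\gamma(2),\gamma(3)=0,1,1,0$, extended componentwise to $\mathbb{Z}_4^N$, and $\phi:\mathbb{Z}_4^N\to\mathbb{Z}_2^{2N}$, $\phi(a)=(\beta(a),\gamma(a))$. The minimal distance of a (possibly nonlinear) code is the minimum Hamming distance between distinct codewords. The weight enumerator of a binary code $C$ of length $N$ is $W_C(x,y)=\sum_{c\in C}x^{N-\mathrm{wt}(c)}y^{\mathrm{wt}(c)}$. Preparata code (standard definition, extended form): let $m\ge 3$ be odd and $F=\mathbb{F}_{2^m}$. Index the $2^{m+1}$ coordinates by two disjoint copies of $F$, so that binary vectors correspond to pairs $(U,V)$ of subsets of $F$ (the supports in the two copies). The Preparata code of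 length $2^{m+1}$ consists of all $(U,V)$ such that $|U|$ and $|V|$ are even, $\sum_{u\in U}u=\sum_{v\in V}v$, and $\sum_{u\in U}u^3+\bigl(\sum_{u\in U}u\bigr)^3=\sum_{v\in V}v^3$. *)

theory Defs
  imports
    "HOL-Library.Numeral_Type"
    "HOL-Library.Z2"
    "HOL-Computational_Algebra.Polynomial"
begin

text \<open>
  The ring of integers modulo 4 is the numeral type \<^typ>\<open>4\<close>, the field of integers modulo 2
  is \<^typ>\<open>bit\<close>. Words are lists, and codes are sets of words.
\<close>

definition red2 :: "4 \<Rightarrow> bit" where
  "red2 a = (if a = 0 \<or> a = 2 then 0 else 1)"

lemma red2_of_int: "red2 (of_int k) = of_int k"
proof -
  have "(of_int k :: 4) = of_int (k mod 4)" by (simp add: bit0.of_int_eq)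
  moreover have "(of_int k :: bit) = of_int (k mod 4)"
  proof -
    have "(of_int k :: bit) = of_int (4 * (k div 4) + k mod 4)" by simp
    also have "\<dots> = of_int (k mod 4)" by (simp only: of_int_add of_int_mult) simp
    finally show ?thesis .
  qed
  moreover have "k mod 4 = 0 \<or> k mod 4 = 1 \<or> k mod 4 = 2 \<or> k mod 4 = 3" by presburger
  ultimately show ?thesis by (auto simp: red2_def)
qed

definition embed_bit :: "bit \<Rightarrow> 'f::field" where
  "embed_bit b = (if b = 0 then 0 else 1)"

text \<open>
  Primitivity of a polynomial over the field with two elements, relative to a type
  \<^typ>\<open>'f\<close> that is meant to be a field of order \<^term>\<open>2 ^ degree p\<close>.
\<close>

definition primitive_poly :: "'f::field itself \<Rightarrow> bit poly \<Rightarrow> bool" where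
  "primitive_poly F p \<longleftrightarrow>
     (\<exists>\<alpha>::'f. poly (map_poly embed_bit p) \<alpha> = 0 \<and> range (\<lambda>k::nat. \<alpha> ^ k) = UNIV - {0})"

definition is_Z4_lift :: "nat \<Rightarrow> bit poly \<Rightarrow> 4 poly \<Rightarrow> bool" where
  "is_Z4_lift n p h \<longleftrightarrow>
     lead_coeff h = 1 \<and> degree h = degree p \<and> map_poly red2 h = p \<and> h dvd monom 1 n - 1"

text \<open>
  Exact division of polynomials over a ring with zero divisors. The quotient is unique when
  \<^term>\<open>b\<close> is monic.
\<close>

definition poly_quot :: "'a::comm_ring_1 poly \<Rightarrow> 'a poly \<Rightarrow> 'a poly" where
  "poly_quot a b = (THE q. a = b * q)"

text \<open>
  A word \<^term>\<open>c\<close> of length \<^term>\<open>n\<close> represents the class of \<^term>\<open>Poly c\<close> modulo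
  \<^term>\<open>monom 1 n - 1\<close>. This class lies in the ideal generated by the class of \<^term>\<open>f\<close> iff it
  is the class of some multiple of \<^term>\<open>f\<close>.
\<close>

definition cyclic_code :: "nat \<Rightarrow> 'a::comm_ring_1 poly \<Rightarrow> 'a list set" where
  "cyclic_code n f = {c. length c = n \<and> (\<exists>a. monom 1 n - 1 dvd Poly c - a * f)}"

definition parity_extend :: "'a::comm_ring_1 list \<Rightarrow> 'a list" where
  "parity_extend c = c @ [- sum_list c]"

definition dual_code :: "nat \<Rightarrow> 'a::comm_ring_1 list set \<Rightarrow> 'a list set" where
  "dual_code N D = {b. length b = N \<and> (\<forall>a\<in>D. (\<Sum>i<N. a ! i * b ! i) = 0)}"

definition gray_beta :: "4 \<Rightarrow> bit" where
  "gray_beta a = (if a = 0 \<or> a = 1 then 0 else 1)"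

definition gray_gamma :: "4 \<Rightarrow> bit" where
  "gray_gamma a = (if a = 0 \<or> a = 3 then 0 else 1)"

definition gray_map :: "4 list \<Rightarrow> bit list" where
  "gray_map a = map gray_beta a @ map gray_gamma a"

definition hamming_dist :: "'a list \<Rightarrow> 'a list \<Rightarrow> nat" where
  "hamming_dist c d = card {i. i < length c \<and> c ! i \<noteq> d ! i}"

definition hamming_weight :: "bit list \<Rightarrow> nat" where
  "hamming_weight c = card {i. i < length c \<and> c ! i \<noteq> 0}"

definition min_distance :: "'a list set \<Rightarrow> nat" where
  "min_distance C = Min {hamming_dist c d | c d. c \<in> C \<and> d \<in> C \<and> c \<noteq> d}"

text \<open>
  The weight enumerator is a polynomial in two variables: \<^term>\<open>x\<close> is the outer
  variable and \<^term>\<open>y\<close> the inner one, so that the summand of \<^term>\<open>c\<close> is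
  \<^term>\<open>x ^ (N - hamming_weight c) * y ^ hamming_weight c\<close>.
\<close>

definition weight_enumerator :: "nat \<Rightarrow> bit list set \<Rightarrow> int poly poly" where
  "weight_enumerator N C =
     (\<Sum>c\<in>C. monom (monom 1 (hamming_weight c)) (N - hamming_weight c))"

text \<open>
  The extended Preparata code over a finite field \<^typ>\<open>'f\<close>. The list \<^term>\<open>fs\<close> enumerates
  the field and fixes the order of the coordinates inside each of its two copies.
\<close>

definition preparata_code :: "'f::{field,finite} list \<Rightarrow> bit list set" where
  "preparata_code fs =
     {map (\<lambda>x. of_bool (x \<in> U)) fs @ map (\<lambda>x. of_bool (x \<in> V)) fs | U V.
        even (card U) \<and> even (card V) \<and>
        (\<Sum>u\<in>U. u) = (\<Sum>v\<in>V. v) \<and>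
        (\<Sum>u\<in>U. u ^ 3) + (\<Sum>u\<in>U. u) ^ 3 = (\<Sum>v\<in>V. v ^ 3)}"

end

theory Submission
  imports Defs "HOL-Library.Product_Plus"
begin

text \<open>
  A binary code of length \<^term>\<open>N\<close> (with \<^term>\<open>N mod 3 = 1\<close>) all of whose words have even weight, with
  minimal distance at least 6 and with \<^term>\<open>2 ^ N / N ^ 2\<close> words attains the Johnson bound. Hence every word
  of odd weight has one codeword at distance 1 and none at distance 3, or none at distance 1 and
  \<^term>\<open>(N - 1) / 3\<close> at distance 3. Summed over all words of a given odd weight, this becomes a recurrence
  that determines the weight distribution of a code containing 0. So it suffices to compute
  size and minimal distance of both codes; no MacWilliams transform is needed.

  On the quaternary side the ring of Witt vectors of length 2 over the field replaces the Galois ring.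
  Evaluation at the Teichmueller representative of a root of \<^term>\<open>h2\<close> is a bijection from the polynomials of
  degree less than \<^term>\<open>m\<close>, which gives the lift \<^term>\<open>h\<close> and the parity check equations of its code,
  and the words of small Lee weight are excluded by hand.
\<close>

section \<open>Nearly perfect codes\<close>

text \<open>Neither binary code is assumed linear, so differences of codewords cannot simply be
  replaced by codewords. Each side has its own substitute: a translation on the Preparata side, and
  on the other side linearity over the integers modulo 4, carried to Hamming distance by the Gray
  map. The size \<open>2 ^ N / N ^ 2\<close> is exactly the one at which the Johnson bound, averaged
  over all words of odd weight, leaves no slack. That m is odd enters only as 2 ^ m mod 3 = 2. This
  gives N mod 3 = 1 for N = 2 ^ (m + 1), makes cubing a bijection of the field, and makes x ^ 2 + x
  * y + y ^ 2 vanish only at the origin; each of the two distance arguments has a case that ends at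
  this form. The Witt vectors are built from the field alone. A Galois ring taken as a quotient by
  \<open>h\<close> would presuppose the lift; here \<open>h\<close> comes out of a count:
  polynomials of degree less than m over the integers modulo 4 and Witt vectors both number 4 ^ m,
  so X ^ m equals a polynomial of lower degree at the Teichmueller representative.\<close>

lemma sym_diff_cancel_left: "sym_diff A (sym_diff A B) = B"
  by blast

lemma even_card_sym_diff:
  assumes "finite A" "finite B"
  shows "even (card (sym_diff A B)) \<longleftrightarrow> even (card A + card B)"
proof -
  have "card (sym_diff A B) = card (A - B) + card (B - A)"
    by (rule card_Un_disjoint) (use assms in auto)
  moreover have "card A = card (A - B) + card (A \<inter> B)"
    using assms by (metis card_Diff_subset_Int card_mono finite_Int inf_le1 le_add_diff_inverse2)
  moreover have "card B = card (B - A) + card (A \<inter> B)"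
    using assms by (metis card_Diff_subset_Int card_mono finite_Int inf_le1 le_add_diff_inverse2 inf_commute)
  ultimately show ?thesis by (simp only: even_add) blast
qed

lemma card_sym_diff_triangle:
  assumes "finite A" "finite B" "finite C"
  shows "card (sym_diff A C) \<le> card (sym_diff B A) + card (sym_diff B C)"
proof -
  have "card (sym_diff A C) \<le> card (sym_diff B A \<union> sym_diff B C)"
    by (rule card_mono) (use assms in auto)
  also have "\<dots> \<le> card (sym_diff B A) + card (sym_diff B C)" by (rule card_Un_le)
  finally show ?thesis .
qed

text \<open>Toggling one fixed point of \<open>I\<close> exchanges the two parities.\<close>

lemma card_odd_subsets:
  assumes "finite I" "I \<noteq> {}"
  shows "card {v. v \<subseteq> I \<and> odd (card v)} = 2 ^ (card I - 1)"
    and "card {v. v \<subseteq> I \<and> even (card v)} = 2 ^ (card I - 1)"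
proof -
  obtain x where x: "x \<in> I" using assms by blast
  have "bij_betw (sym_diff {x}) {v. v \<subseteq> I \<and> odd (card v)} {v. v \<subseteq> I \<and> even (card v)}"
  proof (rule bij_betw_byWitness[where f' = "sym_diff {x}"])
    have *: "sym_diff {x} v \<subseteq> I \<and> even (card (sym_diff {x} v)) = odd (card v)" if "v \<subseteq> I" for v
      using that x even_card_sym_diff[of "{x}" v] finite_subset[OF that assms(1)] by auto
    show "sym_diff {x} ` {v. v \<subseteq> I \<and> odd (card v)} \<subseteq> {v. v \<subseteq> I \<and> even (card v)}"
      using * by blast
    show "sym_diff {x} ` {v. v \<subseteq> I \<and> even (card v)} \<subseteq> {v. v \<subseteq> I \<and> odd (card v)}"
      using * by blast
  qed auto
  then have eq: "card {v. v \<subseteq> I \<and> odd (card v)} = card {v. v \<subseteq> I \<and> even (card v)}"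
    by (rule bij_betw_same_card)
  have "card (Pow I) = card ({v. v \<subseteq> I \<and> odd (card v)} \<union> {v. v \<subseteq> I \<and> even (card v)})"
    by (rule arg_cong[where f = card]) auto
  also have "\<dots> = card {v. v \<subseteq> I \<and> odd (card v)} + card {v. v \<subseteq> I \<and> even (card v)}"
    by (rule card_Un_disjoint) (use assms in auto)
  finally have sum: "2 ^ card I = 2 * card {v. v \<subseteq> I \<and> odd (card v)}"
    using eq assms by (simp add: card_Pow)
  moreover have "(2::nat) ^ card I = 2 * 2 ^ (card I - 1)"
    using assms by (metis card_gt_0_iff power_eq_if not_gr_zero less_irrefl)
  ultimately show "card {v. v \<subseteq> I \<and> odd (card v)} = 2 ^ (card I - 1)" by simp
  then show "card {v. v \<subseteq> I \<and> even (card v)} = 2 ^ (card I - 1)" using eq by simp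
qed

lemma card_sphere:
  assumes "finite I" "c \<subseteq> I"
  shows "card {v. v \<subseteq> I \<and> card (sym_diff v c) = t} = card I choose t"
proof -
  have "bij_betw (\<lambda>v. sym_diff v c) {v. v \<subseteq> I \<and> card (sym_diff v c) = t} {s. s \<subseteq> I \<and> card s = t}"
  proof (rule bij_betw_byWitness[where f' = "\<lambda>v. sym_diff v c"])
    show "(\<lambda>v. sym_diff v c) ` {s. s \<subseteq> I \<and> card s = t} \<subseteq> {v. v \<subseteq> I \<and> card (sym_diff v c) = t}"
    proof (rule image_subsetI)
      fix s assume s: "s \<in> {s. s \<subseteq> I \<and> card s = t}"
      have "sym_diff (sym_diff s c) c = s" by blast
      then show "sym_diff s c \<in> {v. v \<subseteq> I \<and> card (sym_diff v c) = t}"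
        using s assms(2) by auto
    qed
  qed (use assms(2) in auto)
  then show ?thesis using n_subsets[OF assms(1)] by (simp add: bij_betw_same_card)
qed

text \<open>Words are represented by their supports, so that the difference of two words is a
  symmetric difference and the Hamming distance its cardinality. The size is stated as a product to
  avoid division of natural numbers; \<open>{} \<in> C\<close> starts the recurrence for the
  weights.\<close>

definition nearly_perfect :: "'a set \<Rightarrow> 'a set set \<Rightarrow> bool" where
  "nearly_perfect I C \<longleftrightarrow> finite I \<and> card I mod 3 = 1 \<and> C \<subseteq> Pow I \<and> {} \<in> C \<and>
     (\<forall>c\<in>C. even (card c)) \<and> (\<forall>c\<in>C. \<forall>d\<in>C. c \<noteq> d \<longrightarrow> 6 \<le> card (sym_diff c d)) \<and>
     card C * card I ^ 2 = 2 ^ card I"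

definition at_distance :: "'a set set \<Rightarrow> nat \<Rightarrow> 'a set \<Rightarrow> 'a set set" where
  "at_distance C t v = {c \<in> C. card (sym_diff v c) = t}"

lemma sum_at_distance:
  assumes "finite C" "finite V"
  shows "(\<Sum>v\<in>V. card (at_distance C t v)) = (\<Sum>c\<in>C. card {v\<in>V. card (sym_diff v c) = t})"
  unfolding at_distance_def
  by (rule sum_multicount_gen[where R = "\<lambda>v c. card (sym_diff v c) = t"]) (use assms in auto)

text \<open>The Johnson bound: the differences from \<^term>\<open>v\<close> to the codewords at distance 3 are disjoint.\<close>

lemma nearly_perfect_le:
  assumes C: "nearly_perfect I C" and v: "v \<subseteq> I" "odd (card v)"
  shows "(card I - 1) * card (at_distance C 1 v) + 3 * card (at_distance C 3 v) \<le> card I - 1"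
proof -
  have I: "finite I" "card I mod 3 = 1" "C \<subseteq> Pow I" using C by (auto simp: nearly_perfect_def)
  have fin: "finite c" if "c \<in> C" for c using that I by (auto intro: finite_subset)
  have finC: "finite C" using I by (auto intro: finite_subset)
  have finv: "finite v" using v I by (auto intro: finite_subset)
  have far: "6 \<le> card (sym_diff v c) + card (sym_diff v d)" if "c \<in> C" "d \<in> C" "c \<noteq> d" for c d
  proof -
    have "6 \<le> card (sym_diff c d)" using C that by (auto simp: nearly_perfect_def)
    then show ?thesis using card_sym_diff_triangle[OF fin[OF that(1)] finv fin[OF that(2)]] by simp
  qed
  show ?thesis
  proof (cases "at_distance C 1 v = {}")
    case False
    then obtain c where c: "c \<in> C" "card (sym_diff v c) = 1" by (auto simp: at_distance_def)
    \<comment> \<open>A codeword at distance 1 pushes all others to distance at least 5.\<close>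
    have "at_distance C 1 v = {c}" "at_distance C 3 v = {}"
      using far[OF c(1)] c by (fastforce simp: at_distance_def)+
    then show ?thesis by simp
  next
    case True
    have "3 * card ((\<lambda>c. sym_diff v c) ` at_distance C 3 v) = card (\<Union>((\<lambda>c. sym_diff v c) ` at_distance C 3 v))"
    proof (rule card_partition)
      show "finite ((\<lambda>c. sym_diff v c) ` at_distance C 3 v)" using finC by (simp add: at_distance_def)
      have "\<Union>((\<lambda>c. sym_diff v c) ` at_distance C 3 v) \<subseteq> I"
        using I v by (auto simp: at_distance_def)
      then show "finite (\<Union>((\<lambda>c. sym_diff v c) ` at_distance C 3 v))" using I by (auto intro: finite_subset)
      show "card s = 3" if "s \<in> (\<lambda>c. sym_diff v c) ` at_distance C 3 v" for s
        using that by (auto simp: at_distance_def)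
      fix s t assume "s \<in> (\<lambda>c. sym_diff v c) ` at_distance C 3 v"
        "t \<in> (\<lambda>c. sym_diff v c) ` at_distance C 3 v" and "s \<noteq> t"
      then obtain c d where cd: "c \<in> C" "d \<in> C" "c \<noteq> d" "s = sym_diff v c" "t = sym_diff v d"
        "card s = 3" "card t = 3" by (auto simp: at_distance_def)
      have fst: "finite s" "finite t" using cd finv fin by auto
      have "sym_diff c d = sym_diff s t" unfolding cd(4,5) by blast
      moreover have "6 \<le> card (sym_diff c d)" using C cd(1-3) unfolding nearly_perfect_def by blast
      ultimately have "6 \<le> card (sym_diff s t)" by (simp only:)
      also have "card (sym_diff s t) = card (s - t) + card (t - s)"
        by (rule card_Un_disjoint) (use fst in auto)
      \<comment> \<open>Two sets of size 3 whose symmetric difference has at least 6 elements share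
        nothing.\<close>
      finally have "3 \<le> card (s - t)" using cd fst card_mono[of t "t - s"] card_mono[of s "s - t"] by auto
      then have "s - t = s" using cd fst by (metis Diff_subset card_seteq)
      then show "s \<inter> t = {}" by blast
    qed
    also have "\<dots> \<le> card I" by (rule card_mono) (use I v in \<open>auto simp: at_distance_def\<close>)
    also have "card ((\<lambda>c. sym_diff v c) ` at_distance C 3 v) = card (at_distance C 3 v)"
      by (rule card_image, rule inj_onI) (metis sym_diff_cancel_left)
    finally have "3 * card (at_distance C 3 v) \<le> card I" .
    \<comment> \<open>A multiple of 3 that is at most N is at most N - 1, as N mod 3 = 1.\<close>
    then have "3 * card (at_distance C 3 v) \<le> card I - 1" using I(2) by presburger
    then show ?thesis using True by simp
  qed
qed

text \<open>Summed over all odd words, the left side can be counted from the codewords: each, having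
  even weight, sees N odd words at distance 1 and \<open>N choose 3\<close> at distance 3. The size
  of \<open>C\<close> makes this total equal to the total of the upper bounds in
  \<open>nearly_perfect_le\<close>, so none of these bounds is strict.\<close>

lemma nearly_perfect_eq:
  assumes C: "nearly_perfect I C" and v: "v \<subseteq> I" "odd (card v)"
  shows "(card I - 1) * card (at_distance C 1 v) + 3 * card (at_distance C 3 v) = card I - 1"
proof -
  let ?N = "card I" and ?O = "{v. v \<subseteq> I \<and> odd (card v)}"
  let ?f = "\<lambda>v. (?N - 1) * card (at_distance C 1 v) + 3 * card (at_distance C 3 v)"
  have I: "finite I" "?N mod 3 = 1" "C \<subseteq> Pow I" "card C * ?N ^ 2 = 2 ^ ?N"
    using C by (auto simp: nearly_perfect_def)
  have N0: "?N \<noteq> 0" using I by (intro notI) simp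
  then have I0: "I \<noteq> {}" using I by auto
  have finC: "finite C" using I by (auto intro: finite_subset)
  have finO: "finite ?O" using I by simp
  have sphere: "card {v \<in> ?O. card (sym_diff v c) = t} = ?N choose t" if "c \<in> C" "odd t" for c t
  proof -
    have "odd (card v)" if "v \<subseteq> I" "card (sym_diff v c) = t" for v
      using that \<open>c \<in> C\<close> \<open>odd t\<close> I C even_card_sym_diff[of v c]
      by (auto simp: nearly_perfect_def intro: finite_subset)
    then have "{v \<in> ?O. card (sym_diff v c) = t} = {v. v \<subseteq> I \<and> card (sym_diff v c) = t}" by auto
    then show ?thesis using card_sphere[of I c t] I that by auto
  qed
  have "sum ?f ?O = (?N - 1) * (\<Sum>v\<in>?O. card (at_distance C 1 v)) + 3 * (\<Sum>v\<in>?O. card (at_distance C 3 v))"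
    by (simp add: sum.distrib sum_distrib_left)
  also have "\<dots> = (?N - 1) * (card C * ?N) + 3 * (card C * (?N choose 3))"
    by (simp only: sum_at_distance[OF finC finO]) (simp add: sphere choose_one del: One_nat_def mem_Collect_eq)
  also have "\<dots> = (?N - 1) * 2 ^ (?N - 1)"
  proof -
    obtain k where k: "?N = Suc k" using N0 by (cases ?N) auto
    \<comment> \<open>Doubling clears the denominators: 2 * (N - 1) * N + N * (N - 1) * (N - 2) = (N
      - 1) * N ^ 2.\<close>
    have "2 * ((?N - 1) * (card C * ?N) + 3 * (card C * (?N choose 3)))
      = card C * (2 * (?N - 1) * ?N + 6 * (?N choose 3))"
    proof -
      have "2 * (a * (c * b) + 3 * (c * d)) = c * (2 * a * b + 6 * d)" for a b c d :: nat
        by (simp add: algebra_simps)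
      then show ?thesis .
    qed
    also have "6 * (?N choose 3) = ?N * (?N - 1) * (?N - 2)"
    proof -
      have "3 * (?N choose 3) = ?N * ((?N - 1) choose 2)"
        using Suc_times_binomial_eq[of "?N - 1" 2] k by (simp add: numeral_3_eq_3 numeral_2_eq_2 mult.commute)
      moreover have "2 * ((?N - 1) choose 2) = (?N - 1) * (?N - 2)"
      proof -
        have "even ((?N - 1) * (?N - 2))" by (cases "even ?N") auto
        moreover have "?N - 2 = ?N - 1 - 1" by simp
        ultimately show ?thesis by (simp only: choose_two) simp
      qed
      ultimately have "6 * (?N choose 3) = ?N * ((?N - 1) * (?N - 2))"
        by (metis mult.assoc mult.commute mult_2 numeral_Bit0 distrib_right)
      then show ?thesis by (simp only: mult.assoc)
    qed
    also have "2 * (?N - 1) * ?N + ?N * (?N - 1) * (?N - 2) = (?N - 1) * ?N ^ 2"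
      unfolding k by (cases k) (auto simp: power2_eq_square algebra_simps)
    also have "card C * ((?N - 1) * ?N ^ 2) = (?N - 1) * (2 * 2 ^ (?N - 1))"
      using I(4) k by (simp add: algebra_simps)
    finally show ?thesis by simp
  qed
  also have "\<dots> = (\<Sum>v\<in>?O. ?N - 1)" using card_odd_subsets(1)[OF I(1) I0] by simp
  finally have "sum ?f ?O = (\<Sum>v\<in>?O. ?N - 1)" .
  moreover have "\<forall>v\<in>?O. ?f v \<le> ?N - 1" using nearly_perfect_le[OF C] by blast
  ultimately have "\<forall>v\<in>?O. ?f v = ?N - 1"
    using sum_strict_mono_ex1[OF finO, of ?f "\<lambda>_. ?N - 1"] by (metis (mono_tags, lifting) less_irrefl order_le_less)
  then show ?thesis using v by blast
qed

text \<open>A permutation of \<open>I\<close> that carries \<open>c\<close> onto \<open>d\<close>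
  preserves weights and distances. Hence, in a sum over all words of a fixed weight, the
  contribution of a codeword depends only on its weight.\<close>

lemma card_sphere_section_eq:
  assumes "finite I" "c \<subseteq> I" "d \<subseteq> I" "card c = card d"
  shows "card {v. v \<subseteq> I \<and> card v = j \<and> card (sym_diff v c) = t} =
    card {v. v \<subseteq> I \<and> card v = j \<and> card (sym_diff v d) = t}"
proof -
  have fin: "finite c" "finite d" using assms by (auto intro: finite_subset)
  have "card (I - c) = card (I - d)" using assms fin by (simp add: card_Diff_subset)
  then obtain f g where f: "bij_betw f c d" and g: "bij_betw g (I - c) (I - d)"
    using assms fin finite_same_card_bij[of c d] finite_same_card_bij[of "I - c" "I - d"] by auto
  define \<pi> where "\<pi> x = (if x \<in> c then f x else g x)" for x
  have "bij_betw \<pi> c d" using f by (simp add: \<pi>_def cong: bij_betw_cong)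
  moreover have "bij_betw \<pi> (I - c) (I - d)"
    using g bij_betw_cong[of "I - c" g \<pi> "I - d"] by (simp add: \<pi>_def)
  ultimately have "bij_betw \<pi> (c \<union> (I - c)) (d \<union> (I - d))" by (rule bij_betw_combine) blast
  then have \<pi>: "inj_on \<pi> I" "\<pi> ` I = I" "\<pi> ` c = d"
    using assms \<open>bij_betw \<pi> c d\<close> by (auto simp: bij_betw_def Un_absorb1)
  have *: "card (sym_diff (\<pi> ` v) d) = card (sym_diff v c)" "card (\<pi> ` v) = card v" if "v \<subseteq> I" for v
  proof -
    have "sym_diff (\<pi> ` v) (\<pi> ` c) = \<pi> ` sym_diff v c"
      using inj_on_image_set_diff[OF \<pi>(1), of v c] inj_on_image_set_diff[OF \<pi>(1), of c v] that assms(2)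
      by (auto simp: image_Un)
    then show "card (sym_diff (\<pi> ` v) d) = card (sym_diff v c)"
      using \<pi>(3) that assms(2) by (metis (no_types, lifting) \<pi>(1) Diff_subset card_image inj_on_subset order_trans Un_least)
    show "card (\<pi> ` v) = card v" using that \<pi>(1) by (meson card_image inj_on_subset)
  qed
  have "inj_on (image \<pi>) (Pow I)" using \<pi>(1) by (rule inj_on_image_Pow)
  then have inj: "inj_on (image \<pi>) {v. v \<subseteq> I \<and> card v = j \<and> card (sym_diff v c) = t}"
    by (rule inj_on_subset) auto
  have "image \<pi> ` {v. v \<subseteq> I \<and> card v = j \<and> card (sym_diff v c) = t} =
      {v. v \<subseteq> I \<and> card v = j \<and> card (sym_diff v d) = t}"
  proof (intro equalityI subsetI)
    fix w assume w: "w \<in> {v. v \<subseteq> I \<and> card v = j \<and> card (sym_diff v d) = t}"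
    then obtain v where "v \<subseteq> I" "w = \<pi> ` v" using \<pi>(2) by (metis (no_types, lifting) mem_Collect_eq subset_image_iff)
    then show "w \<in> image \<pi> ` {v. v \<subseteq> I \<and> card v = j \<and> card (sym_diff v c) = t}"
      using w * by auto
  next
    fix w assume "w \<in> image \<pi> ` {v. v \<subseteq> I \<and> card v = j \<and> card (sym_diff v c) = t}"
    then obtain v where "w = \<pi> ` v" "v \<subseteq> I" "card v = j" "card (sym_diff v c) = t" by auto
    then show "w \<in> {v. v \<subseteq> I \<and> card v = j \<and> card (sym_diff v d) = t}"
      using *[of v] image_mono[of v I \<pi>] \<pi>(2) by simp
  qed
  then show ?thesis using card_image[OF inj] by simp
qed

text \<open>Summing \<open>nearly_perfect_eq\<close> over all words of weight \<open>w - 3\<close>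
  gives a triangular system: codewords heavier than \<open>w\<close> contribute 0, those of weight
  \<open>w\<close> a common positive amount, and lighter ones are covered by induction.\<close>

lemma nearly_perfect_unique:
  assumes C: "nearly_perfect I C" and D: "nearly_perfect I D"
  shows "card {c \<in> C. card c = w} = card {c \<in> D. card c = w}"
proof (induction w rule: less_induct)
  case (less w)
  have I: "finite I" "finite C" "finite D" "C \<subseteq> Pow I" "D \<subseteq> Pow I"
    using C D by (auto simp: nearly_perfect_def intro: finite_subset)
  consider "odd w" | "w = 0" | "w = 2" | "card I < w" | "even w" "w \<ge> 4" "w \<le> card I"
  proof -
    have "w = 0 \<or> w = 2 \<or> odd w \<or> w \<ge> 4" by presburger
    then show ?thesis using that by linarith
  qed
  then show ?case
  proof cases
    case 1
    then have "{c \<in> C. card c = w} = {}" "{c \<in> D. card c = w} = {}"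
      using C D by (auto simp: nearly_perfect_def)
    then show ?thesis by (simp only:)
  next
    case 2
    have "{c \<in> E. card c = w} = {{}}" if "nearly_perfect I E" for E
    proof -
      have "finite c" if "c \<in> E" for c
        using that \<open>nearly_perfect I E\<close> by (auto simp: nearly_perfect_def intro: finite_subset)
      then show ?thesis using that 2 by (auto simp: nearly_perfect_def)
    qed
    then show ?thesis using C D by simp
  next
    case 3
    \<comment> \<open>A codeword of weight 2 would be at distance 2 from the empty word.\<close>
    have "{c \<in> E. card c = w} = {}" if "nearly_perfect I E" for E
      using that 3 by (fastforce simp: nearly_perfect_def)
    then show ?thesis using C D by (simp only:)
  next
    case 4
    have "{c \<in> E. card c = w} = {}" if "E \<subseteq> Pow I" for E
      using that 4 card_mono[OF I(1)] by (auto simp: not_le[symmetric])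
    then show ?thesis using I(4,5) by (simp only:)
  next
    case 5
    \<comment> \<open>Subtracting 3 keeps weight \<open>w\<close> within distance 3 and heavier
      codewords out of reach, and it turns the even \<open>w\<close> into an odd weight, as
      \<open>nearly_perfect_eq\<close> demands.\<close>
    define j where "j = w - 3"
    define S where "S t c = {v. v \<subseteq> I \<and> card v = j \<and> card (sym_diff v c) = t}" for t c
    define K where "K c = (card I - 1) * card (S 1 c) + 3 * card (S 3 c)" for c
    have j: "odd j" "w = j + 3" using 5 by (auto simp: j_def)
    have Kcong: "K c = K d" if "c \<subseteq> I" "d \<subseteq> I" "card c = card d" for c d
      unfolding K_def S_def using card_sphere_section_eq[OF I(1) that] by simp
    obtain r where r: "r \<subseteq> I" "card r = w" using 5 by (meson obtain_subset_with_card_n)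
    have "K r > 0"
    proof -
      obtain v where v: "v \<subseteq> r" "card v = j" using r j by (metis le_add1 obtain_subset_with_card_n)
      have "finite v" using v r I by (auto intro: finite_subset)
      then have "card (sym_diff v r) = 3"
        using v r j by (simp add: Diff_eq_empty_iff[THEN iffD2] card_Diff_subset)
      then have "v \<in> S 3 r" using v r by (auto simp: S_def)
      moreover have "finite (S 3 r)" using I by (simp add: S_def)
      ultimately have "card (S 3 r) > 0" by (auto simp: card_gt_0_iff)
      then show ?thesis by (simp add: K_def)
    qed
    have Kzero: "K c = 0" if "c \<subseteq> I" "card c > w" for c
    proof -
      have "v \<notin> S t c" if "t \<le> 3" for v t
      proof
        assume "v \<in> S t c"
        then have v: "finite v" "card v = j" "card (sym_diff v c) = t"
          using I by (auto simp: S_def intro: finite_subset)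
        have "card c \<le> card (sym_diff v c \<union> v)"
          by (rule card_mono) (use v \<open>c \<subseteq> I\<close> I finite_subset in auto)
        also have "\<dots> \<le> t + j" using card_Un_le[of "sym_diff v c" v] v by simp
        finally show False using that j \<open>card c > w\<close> by simp
      qed
      then have "S 1 c = {}" "S 3 c = {}" by auto
      then show ?thesis by (simp add: K_def)
    qed
    have total: "sum K {c \<in> E. card c < w} + card {c \<in> E. card c = w} * K r =
        (\<Sum>v | v \<subseteq> I \<and> card v = j. card I - 1)" if E: "nearly_perfect I E" for E
    proof -
      let ?V = "{v. v \<subseteq> I \<and> card v = j}"
      have EI: "E \<subseteq> Pow I" and finE: "finite E" using E I(1) by (auto simp: nearly_perfect_def intro: finite_subset)
      have finV: "finite ?V" using I(1) by simp
      have "(\<Sum>v\<in>?V. card I - 1) = (\<Sum>v\<in>?V. (card I - 1) * card (at_distance E 1 v) + 3 * card (at_distance E 3 v))"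
        by (rule sum.cong) (use nearly_perfect_eq[OF E] j in auto)
      also have "\<dots> = sum K E"
      proof -
        have "S t c = {v \<in> ?V. card (sym_diff v c) = t}" for t c by (auto simp: S_def)
        then show ?thesis
          by (simp add: K_def sum.distrib sum_distrib_left[symmetric] sum_at_distance[OF finE finV] del: mem_Collect_eq)
      qed
      also have "\<dots> = sum K {c \<in> E. card c \<le> w}"
      proof (rule sum.mono_neutral_right)
        show "\<forall>c\<in>E - {c \<in> E. card c \<le> w}. K c = 0"
        proof
          fix c assume "c \<in> E - {c \<in> E. card c \<le> w}"
          then have "c \<subseteq> I" "card c > w" using EI by auto
          then show "K c = 0" by (rule Kzero)
        qed
      qed (use finE in auto)
      also have "{c \<in> E. card c \<le> w} = {c \<in> E. card c < w} \<union> {c \<in> E. card c = w}" by auto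
      also have "sum K \<dots> = sum K {c \<in> E. card c < w} + sum K {c \<in> E. card c = w}"
        by (rule sum.union_disjoint) (use finE in auto)
      also have "sum K {c \<in> E. card c = w} = (\<Sum>c | c \<in> E \<and> card c = w. K r)"
        by (rule sum.cong[OF refl], rule Kcong) (use r EI in auto)
      finally show ?thesis by simp
    qed
    have "sum K {c \<in> C. card c < w} = sum K {c \<in> D. card c < w}"
    proof -
      \<comment> \<open>\<open>k i\<close> is the common value of \<open>K\<close> on sets of size
        \<open>i\<close>, so that the sum groups by weight and the induction hypothesis
        applies.\<close>
      define k where "k i = K (SOME c. c \<subseteq> I \<and> card c = i)" for i
      have k: "K c = k (card c)" if "c \<subseteq> I" for c
      proof -
        have "\<exists>d. d \<subseteq> I \<and> card d = card c" using that by blast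
        then have "(SOME d. d \<subseteq> I \<and> card d = card c) \<subseteq> I" "card (SOME d. d \<subseteq> I \<and> card d = card c) = card c"
          by (metis (mono_tags, lifting) someI_ex)+
        then show ?thesis unfolding k_def by (intro Kcong) (use that in auto)
      qed
      have "sum K {c \<in> E. card c < w} = (\<Sum>i<w. card {c \<in> E. card c = i} * k i)"
        if "finite E" "E \<subseteq> Pow I" for E
      proof -
        have "sum K {c \<in> E. card c < w} = (\<Sum>i<w. sum K {c \<in> {c \<in> E. card c < w}. card c = i})"
          by (rule sum.group[symmetric]) (use that in auto)
        also have "\<dots> = (\<Sum>i<w. \<Sum>c | c \<in> E \<and> card c = i. k i)"
        proof (intro sum.cong)
          fix i c assume "c \<in> {c \<in> E. card c = i}"
          then show "K c = k i" using k[of c] that by auto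
        qed auto
        finally show ?thesis by simp
      qed
      then show ?thesis using less.IH I by simp
    qed
    then have "card {c \<in> C. card c = w} * K r = card {c \<in> D. card c = w} * K r"
      using total[OF C] total[OF D] by linarith
    then show ?thesis using \<open>K r > 0\<close> by simp
  qed
qed

section \<open>Binary words and their supports\<close>

definition support :: "bit list \<Rightarrow> nat set" where
  "support c = {i. i < length c \<and> c ! i \<noteq> 0}"

lemma hamming_weight_support: "hamming_weight c = card (support c)"
  by (simp add: hamming_weight_def support_def)

lemma hamming_dist_support:
  assumes "length c = length d"
  shows "hamming_dist c d = card (sym_diff (support c) (support d))"
proof -
  have "{i. i < length c \<and> c ! i \<noteq> d ! i} = sym_diff (support c) (support d)"
    using assms by (auto simp: support_def)
  then show ?thesis by (simp add: hamming_dist_def)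
qed

lemma inj_on_support: "inj_on support {c. length c = N}"
proof (rule inj_onI)
  fix c d assume *: "c \<in> {c. length c = N}" "d \<in> {c. length c = N}" "support c = support d"
  then have "(c ! i \<noteq> 0) = (d ! i \<noteq> 0)" if "i < N" for i
    using that by (auto simp: support_def set_eq_iff)
  then show "c = d" using * by (intro nth_equalityI) (auto, metis bit_not_zero_iff)
qed

lemma weight_enumerator_eqI:
  assumes "\<And>c. c \<in> P \<Longrightarrow> length c = N" "\<And>c. c \<in> Q \<Longrightarrow> length c = N"
    and P: "nearly_perfect {..<N} (support ` P)" and Q: "nearly_perfect {..<N} (support ` Q)"
  shows "weight_enumerator N P = weight_enumerator N Q"
proof -
  let ?f = "\<lambda>w. monom (monom 1 w) (N - w) :: int poly poly"
  have *: "weight_enumerator N R = (\<Sum>w\<le>N. of_nat (card {s \<in> support ` R. card s = w}) * ?f w)"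
    if R: "\<And>c. c \<in> R \<Longrightarrow> length c = N" for R
  proof -
    have sub: "support ` R \<subseteq> Pow {..<N}" using R by (auto simp: support_def)
    then have fin: "finite (support ` R)" by (rule finite_subset) simp
    have "weight_enumerator N R = (\<Sum>c\<in>R. ?f (card (support c)))"
      by (simp add: weight_enumerator_def hamming_weight_support)
    also have "\<dots> = (\<Sum>s\<in>support ` R. ?f (card s))"
      using inj_on_support by (subst sum.reindex) (auto intro: inj_on_subset R)
    also have "\<dots> = (\<Sum>w\<le>N. \<Sum>s | s \<in> support ` R \<and> card s = w. ?f (card s))"
      using sub card_mono[of "{..<N}"] by (intro sum.group[symmetric] fin) auto
    also have "\<dots> = (\<Sum>w\<le>N. of_nat (card {s \<in> support ` R. card s = w}) * ?f w)"
      by (intro sum.cong) auto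
    finally show ?thesis .
  qed
  show ?thesis using nearly_perfect_unique[OF P Q] assms by (simp add: *)
qed

lemma nearly_perfect_support:
  assumes len: "\<And>c. c \<in> P \<Longrightarrow> length c = N" and "N mod 3 = 1" and zero: "replicate N 0 \<in> P"
    and "\<And>c. c \<in> P \<Longrightarrow> even (hamming_weight c)"
    and dist: "\<And>c d. c \<in> P \<Longrightarrow> d \<in> P \<Longrightarrow> c \<noteq> d \<Longrightarrow> 6 \<le> hamming_dist c d"
    and "card P * N ^ 2 = 2 ^ N"
  shows "nearly_perfect {..<N} (support ` P)"
proof -
  have "support (replicate N 0) = {}" by (auto simp: support_def)
  then have "{} \<in> support ` P" using zero by (metis image_eqI)
  moreover have "card (support ` P) = card P"
    by (rule card_image, rule inj_on_subset[OF inj_on_support]) (use len in auto)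
  moreover have "6 \<le> card (sym_diff (support c) (support d))" if "c \<in> P" "d \<in> P" "support c \<noteq> support d" for c d
    using dist[OF that(1,2)] that hamming_dist_support[of c d] len by auto
  moreover have "support ` P \<subseteq> Pow {..<N}" using len by (auto simp: support_def)
  moreover have "\<forall>c\<in>support ` P. even (card c)" using assms(4) by (auto simp: hamming_weight_support)
  ultimately show ?thesis
    unfolding nearly_perfect_def using assms(2,6) by (auto simp del: One_nat_def)
qed

section \<open>Finite fields of characteristic two\<close>

text \<open>Adding 1 permutes the field, so comparing the two sums of all elements makes the field
  order, a power of 2, equal to 0 in the field.\<close>

lemma char_two:
  assumes "CARD('f::{field,finite}) = 2 ^ m"
  shows "(2::'f) = 0"
proof -
  have "(\<Sum>x\<in>UNIV. x + 1 :: 'f) = (\<Sum>x\<in>UNIV. x)"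
    by (rule sum.reindex_bij_witness[where i = "\<lambda>x. x - 1" and j = "\<lambda>x. x + 1"]) auto
  then have "of_nat CARD('f) = (0::'f)" by (simp add: sum.distrib)
  then show ?thesis using assms by simp
qed

text \<open>Multiplication by \<open>x\<close> permutes the nonzero elements; compare the
  products.\<close>

lemma power_card_minus_one:
  fixes x :: "'f::{field,finite}"
  assumes "x \<noteq> 0"
  shows "x ^ (CARD('f) - 1) = 1"
proof -
  have "(\<Prod>y\<in>UNIV - {0}. x * y) = (\<Prod>y\<in>UNIV - {0}. y)"
    using assms by (intro prod.reindex_bij_witness[where i = "\<lambda>y. y / x" and j = "\<lambda>y. x * y"]) auto
  then have "x ^ (CARD('f) - 1) * (\<Prod>y\<in>UNIV - {0::'f}. y) = (\<Prod>y\<in>UNIV - {0}. y)"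
    by (simp add: prod.distrib card_Diff_singleton)
  then show ?thesis by simp
qed

lemma add_self_eq_0:
  fixes x :: "'a::comm_ring_1"
  assumes "(2::'a) = 0"
  shows "x + x = 0"
  using assms by (metis mult_2 mult_zero_left)

lemma add_eq_0_char_two:
  fixes x y :: "'a::comm_ring_1"
  assumes "(2::'a) = 0"
  shows "x + y = 0 \<longleftrightarrow> x = y"
  using add_self_eq_0[OF assms] by (metis add_right_imp_eq)

lemma char_two_simps:
  fixes x y :: "'a::comm_ring_1"
  assumes "(2::'a) = 0"
  shows "x + x = 0" "x + (x + y) = y" "- x = x" "x - y = x + y"
proof -
  show 1: "x + x = 0" for x :: 'a by (rule add_self_eq_0[OF assms])
  show "x + (x + y) = y" using 1[of x] by (simp add: add.assoc[symmetric])
  show 2: "- x = x" for x :: 'a using 1[of x] by (simp add: neg_eq_iff_add_eq_0)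
  show "x - y = x + y" using 2[of y] by (metis diff_conv_add_uminus)
qed

lemma ex_not_0_1:
  assumes "CARD('f::{field,finite}) = 2 ^ m" "m \<ge> 2"
  shows "\<exists>z::'f. z \<noteq> 0 \<and> z \<noteq> 1"
proof -
  have "card {0, 1::'f} < CARD('f)"
    using assms power_increasing[of 2 m "2::nat"] by simp
  then obtain z :: 'f where "z \<notin> {0, 1}" by (metis UNIV_eq_I less_irrefl)
  then show ?thesis by auto
qed

lemma two_power_mod_3:
  assumes "odd m"
  shows "(2::nat) ^ (m + 1) mod 3 = 1"
proof -
  obtain k where k: "m + 1 = 2 * k" using assms by (metis even_plus_one_iff evenE)
  have "(4::nat) ^ k mod 3 = 1" by (induction k) (auto simp: mod_mult_eq[symmetric] mod_mult_right_eq[symmetric])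
  then show ?thesis unfolding k by (simp add: power_mult)
qed

text \<open>A primitive cube root of unity would have order 3, which does not divide \<^term>\<open>2 ^ m - 1\<close>.\<close>

lemma norm_form_eq_0:
  fixes x y :: "'f::{field,finite}"
  assumes card: "CARD('f) = 2 ^ m" and "odd m" and eq: "x ^ 2 + x * y + y ^ 2 = 0"
  shows "x = 0 \<and> y = 0"
proof -
  have two: "(2::'f) = 0" using card by (rule char_two)
  have y: "y = 0"
  proof (rule ccontr)
    assume y: "y \<noteq> 0"
    then have x: "x \<noteq> 0" using eq by auto
    have "2 * (2::nat) ^ m mod 3 = 1" using two_power_mod_3[OF \<open>odd m\<close>] by simp
    then have "(2::nat) ^ m - 1 = 3 * ((2 ^ m - 1) div 3) + 1" by presburger
    then obtain l where l: "(2::nat) ^ m - 1 = 3 * l + 1" by blast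
    have cube: "x ^ 3 = y ^ 3" using eq by algebra
    \<comment> \<open>Both sides are 1. Since the cubes agree, an exponent that is 1 modulo 3
      isolates \<open>x = y\<close>.\<close>
    have "x ^ (3 * l + 1) = y ^ (3 * l + 1)"
      using power_card_minus_one[OF x] power_card_minus_one[OF y] card l by simp
    then have "x ^ (3 * l) * x = x ^ (3 * l) * y" by (simp add: power_mult cube)
    then have "x = y" using x by simp
    then have "y ^ 2 = 0" using eq by (simp add: power2_eq_square char_two_simps[OF two])
    then show False using y by simp
  qed
  then show ?thesis using eq by simp
qed

lemma inj_cube:
  assumes "CARD('f::{field,finite}) = 2 ^ m" and "odd m"
  shows "inj (\<lambda>x::'f. x ^ 3)"
proof (rule injI)
  fix x y :: 'f assume "x ^ 3 = y ^ 3"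
  then have "(x - y) * (x ^ 2 + x * y + y ^ 2) = 0" by algebra
  then show "x = y" using norm_form_eq_0[OF assms, of x y] by auto
qed

lemma sum_square_char_two:
  fixes f :: "'b \<Rightarrow> 'a::comm_ring_1"
  assumes "(2::'a) = 0"
  shows "(\<Sum>x\<in>A. f x ^ 2) = (\<Sum>x\<in>A. f x) ^ 2"
  using assms by (induction A rule: infinite_finite_induct) (auto simp: power2_sum)

text \<open>Turns \<open>sum f\<close> into a homomorphism from finite sets under symmetric
  difference, the form used by \<open>card_fibres_additive\<close>.\<close>

lemma sum_sym_diff:
  fixes f :: "'b \<Rightarrow> 'a::ab_group_add"
  assumes "\<And>y::'a. y + y = 0" "finite A" "finite B"
  shows "sum f (sym_diff A B) = sum f A + sum f B"
proof -
  have "sum f (sym_diff A B) = sum f (A - B) + sum f (B - A)"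
    by (rule sum.union_disjoint) (use assms in auto)
  moreover have "sum f A = sum f (A \<inter> B) + sum f (A - B)" using assms(2) by (rule sum.Int_Diff)
  moreover have "sum f B = sum f (A \<inter> B) + sum f (B - A)"
    using sum.Int_Diff[OF assms(3), of f A] by (simp add: Int_commute)
  moreover have "sum f (A \<inter> B) + sum f (A - B) + (sum f (A \<inter> B) + sum f (B - A)) =
      (sum f (A \<inter> B) + sum f (A \<inter> B)) + (sum f (A - B) + sum f (B - A))"
    by (simp only: ac_simps)
  ultimately show ?thesis using assms(1)[of "sum f (A \<inter> B)"] by simp
qed

section \<open>The Preparata code\<close>

definition preparata_pair :: "'f::{field,finite} set \<Rightarrow> 'f set \<Rightarrow> bool" where
  "preparata_pair U V \<longleftrightarrow> even (card U) \<and> even (card V) \<and>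
     (\<Sum>u\<in>U. u) = (\<Sum>v\<in>V. v) \<and>
     (\<Sum>u\<in>U. u ^ 3) + (\<Sum>u\<in>U. u) ^ 3 = (\<Sum>v\<in>V. v ^ 3)"

lemma even_less_six: "even (k::nat) \<Longrightarrow> even l \<Longrightarrow> k + l < 6 \<Longrightarrow>
    k = 0 \<and> l = 0 \<or> k = 2 \<and> l = 0 \<or> k = 0 \<and> l = 2 \<or> k = 2 \<and> l = 2 \<or> k = 4 \<and> l = 0 \<or> k = 0 \<and> l = 4"
  by presburger

lemma card_4E:
  assumes "card A = 4"
  obtains a b c d where "A = {a, b, c, d}" "a \<noteq> b" "a \<noteq> c" "a \<noteq> d" "b \<noteq> c" "b \<noteq> d" "c \<noteq> d"
proof -
  have "card A = Suc 3" using assms by simp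
  then obtain a B where B: "A = insert a B" "a \<notin> B" "card B = 3" by (metis card_Suc_eq)
  then obtain b c d where "B = {b, c, d}" "b \<noteq> c" "b \<noteq> d" "c \<noteq> d" by (metis card_3_iff)
  then show ?thesis using B that by auto
qed

text \<open>Even sizes with total below 6 leave few patterns. Two points in one copy have sum 0 and
  coincide; four points in one copy are excluded by a factorization of the sum of cubes, two in each
  copy by \<open>norm_form_eq_0\<close>.\<close>

lemma preparata_pair_small:
  fixes U V :: "'f::{field,finite} set"
  assumes card: "CARD('f) = 2 ^ m" "odd m"
    and pair: "preparata_pair U V" and small: "card U + card V < 6"
  shows "U = {} \<and> V = {}"
proof -
  have two: "(2::'f) = 0" using card(1) by (rule char_two)
  note eq_iff = add_eq_0_char_two[OF two]
  have two_points: "a = b" if "a + b = 0" for a b :: 'f using that eq_iff by simp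
  have four_points: False
    if "a + b + c + d = 0" "a ^ 3 + b ^ 3 + c ^ 3 + d ^ 3 = 0" "a \<noteq> b" "a \<noteq> c" "b \<noteq> c" for a b c d :: 'f
  proof -
    have d: "d = a + b + c" using that(1) eq_iff[of "a + b + c" d] by simp
    \<comment> \<open>(a + b + c) ^ 3 minus the three cubes is 3 * (a + b) * (b + c) * (a + c), and
      3 = 1 in the field.\<close>
    have "(a + b) * (b + c) * (a + c) = a ^ 3 + b ^ 3 + c ^ 3 + d ^ 3" unfolding d
      by (simp add: power3_eq_cube algebra_simps char_two_simps[OF two])
    then have "(a + b) * (b + c) * (a + c) = 0" using that(2) by simp
    then show False using that(3-5) eq_iff by simp
  qed
  have p: "even (card U)" "even (card V)" "(\<Sum>u\<in>U. u) = (\<Sum>v\<in>V. v)"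
     "(\<Sum>u\<in>U. u ^ 3) + (\<Sum>u\<in>U. u) ^ 3 = (\<Sum>v\<in>V. v ^ 3)"
    using pair by (auto simp: preparata_pair_def)
  consider "card U = 0 \<and> card V = 0" | "card U = 2 \<and> card V = 0" | "card U = 0 \<and> card V = 2"
    | "card U = 2 \<and> card V = 2" | "card U = 4 \<and> card V = 0" | "card U = 0 \<and> card V = 4"
    using even_less_six[OF p(1,2) small] by blast
  then show ?thesis
  proof cases
    case 2
    then obtain a b where "U = {a, b}" "a \<noteq> b" "V = {}" by (auto simp: card_2_iff)
    then show ?thesis using p(3) two_points by auto
  next
    case 3
    then obtain a b where "V = {a, b}" "a \<noteq> b" "U = {}" by (auto simp: card_2_iff)
    moreover from this have "a + b = 0" using p(3) by simp
    ultimately show ?thesis using two_points by blast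
  next
    case 4
    then obtain a b c d where U: "U = {a, b}" "a \<noteq> b" and V: "V = {c, d}" "c \<noteq> d"
      by (auto simp: card_2_iff)
    have 1: "a + b = c + d" and 2: "a ^ 3 + b ^ 3 + (a + b) ^ 3 = c ^ 3 + d ^ 3"
      using p(3,4) U V by auto
    have b: "b = a + (c + d)" by (simp add: 1[symmetric] char_two_simps[OF two])
    \<comment> \<open>Eliminating \<open>b\<close> turns the cube equation into \<open>c + d\<close>
      times the norm form at \<open>a + c\<close> and \<open>c + d\<close>; its vanishing would
      force \<open>c = d\<close>.\<close>
    have "(c + d) * ((a + c) ^ 2 + (a + c) * (c + d) + (c + d) ^ 2) =
        (a ^ 3 + b ^ 3 + (a + b) ^ 3) + (c ^ 3 + d ^ 3)"
      unfolding b by (simp add: power3_eq_cube power2_eq_square algebra_simps char_two_simps[OF two])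
    then have "(c + d) * ((a + c) ^ 2 + (a + c) * (c + d) + (c + d) ^ 2) = 0"
      unfolding 2 by (simp only: add_self_eq_0[OF two])
    moreover have "c + d \<noteq> 0" using V eq_iff by simp
    ultimately show ?thesis using norm_form_eq_0[OF card, of "a + c" "c + d"] by auto
  next
    case 5
    then obtain a b c d where "U = {a, b, c, d}" "a \<noteq> b" "a \<noteq> c" "a \<noteq> d" "b \<noteq> c" "b \<noteq> d" "c \<noteq> d" "V = {}"
      by (metis card_4E card_0_eq finite_code)
    then show ?thesis using four_points[of a b c d] p(3,4) by (simp add: add.assoc)
  next
    case 6
    then obtain a b c d where "V = {a, b, c, d}" "a \<noteq> b" "a \<noteq> c" "a \<noteq> d" "b \<noteq> c" "b \<noteq> d" "c \<noteq> d" "U = {}"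
      by (metis card_4E card_0_eq finite_code)
    then show ?thesis using four_points[of a b c d] p(3,4) by (simp add: add.assoc)
  qed simp
qed

text \<open>The code is not linear, but it is distance invariant: the difference of two codewords
  becomes a codeword after a translation in the first copy of the field.\<close>

lemma preparata_pair_sym_diff:
  fixes U V U' V' :: "'f::{field,finite} set"
  assumes two: "(2::'f) = 0" and p: "preparata_pair U V" and p': "preparata_pair U' V'"
  shows "preparata_pair ((+) (\<Sum>u\<in>U. u) ` sym_diff U U') (sym_diff V V')"
proof -
  define s s' where "s = (\<Sum>u\<in>U. u)" and "s' = (\<Sum>u\<in>U'. u)"
  let ?A = "sym_diff U U'" and ?B = "sym_diff V V'"
  have sd: "sum f (sym_diff X Y) = sum f X + sum f Y" for f :: "'f \<Rightarrow> 'f" and X Y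
    by (rule sum_sym_diff) (auto simp: add_self_eq_0[OF two])
  have even: "even (card ?A)" "even (card ?B)"
    using p p' even_card_sym_diff[of U U'] even_card_sym_diff[of V V'] by (auto simp: preparata_pair_def)
  \<comment> \<open>Shifting an even number of summands by \<open>s\<close> leaves their sum
    unchanged.\<close>
  have odd0: "of_nat (card ?A) = (0::'f)" using even(1) two by (auto elim!: evenE)
  have inj: "inj_on ((+) s) ?A" by simp
  have A1: "(\<Sum>u\<in>?A. u) = s + s'" by (simp only: sd s_def s'_def)
  have A2: "(\<Sum>u\<in>?A. u ^ 2) = (s + s') ^ 2" by (simp only: sum_square_char_two[OF two] A1)
  have S1: "(\<Sum>u\<in>(+) s ` ?A. u) = s + s'"
    using odd0 A1 by (simp add: sum.reindex[OF inj] sum.distrib)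
  \<comment> \<open>Of the cross terms, \<open>s ^ 2 * u\<close> and \<open>s * u ^ 2\<close>
    survive in characteristic two, and the sum of the squares is the square of the sum.\<close>
  have "(\<Sum>u\<in>(+) s ` ?A. u ^ 3) = (\<Sum>u\<in>?A. (s + u) ^ 3)" by (simp add: sum.reindex[OF inj])
  also have "\<dots> = (\<Sum>u\<in>?A. s ^ 3 + (s ^ 2 * u + (s * u ^ 2 + u ^ 3)))"
    by (rule sum.cong[OF refl])
      (simp add: power3_eq_cube power2_eq_square algebra_simps char_two_simps[OF two])
  also have "\<dots> = of_nat (card ?A) * s ^ 3 + (s ^ 2 * (\<Sum>u\<in>?A. u) + (s * (\<Sum>u\<in>?A. u ^ 2) + (\<Sum>u\<in>?A. u ^ 3)))"
    by (simp only: sum.distrib sum_distrib_left sum_constant)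
  also have "\<dots> = s ^ 2 * (s + s') + (s * (s + s') ^ 2 + ((\<Sum>u\<in>U. u ^ 3) + (\<Sum>u\<in>U'. u ^ 3)))"
    unfolding A1 A2 odd0 sd[of "\<lambda>u. u ^ 3"] by simp
  finally have S3: "(\<Sum>u\<in>(+) s ` ?A. u ^ 3) =
      s ^ 2 * (s + s') + (s * (s + s') ^ 2 + ((\<Sum>u\<in>U. u ^ 3) + (\<Sum>u\<in>U'. u ^ 3)))" .
  have q: "s = (\<Sum>v\<in>V. v)" "s' = (\<Sum>v\<in>V'. v)"
      "(\<Sum>u\<in>U. u ^ 3) + s ^ 3 = (\<Sum>v\<in>V. v ^ 3)" "(\<Sum>u\<in>U'. u ^ 3) + s' ^ 3 = (\<Sum>v\<in>V'. v ^ 3)"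
    using p p' by (auto simp: preparata_pair_def s_def s'_def)
  have B1: "(\<Sum>v\<in>?B. v) = s + s'" by (simp only: sd q(1,2))
  have B3: "(\<Sum>v\<in>?B. v ^ 3) = ((\<Sum>u\<in>U. u ^ 3) + s ^ 3) + ((\<Sum>u\<in>U'. u ^ 3) + s' ^ 3)" by (simp only: sd q(3,4))
  have "card ((+) s ` ?A) = card ?A" using inj by (rule card_image)
  moreover have "s ^ 2 * (s + s') + (s * (s + s') ^ 2 + (x + y)) + (s + s') ^ 3 = (x + s ^ 3) + (y + s' ^ 3)" for x y :: 'f
    by (simp add: power3_eq_cube power2_eq_square algebra_simps char_two_simps[OF two])
  ultimately show ?thesis
    unfolding preparata_pair_def s_def[symmetric] using even by (simp only: S1 S3 B1 B3)
qed

text \<open>Symmetric difference makes subsets a group, and the fibres of a surjective homomorphism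
  are cosets of its kernel: translation by a preimage of \<open>y + z\<close> exchanges the fibres
  over \<open>y\<close> and \<open>z\<close>.\<close>

lemma card_fibres_additive:
  fixes \<psi> :: "'c set \<Rightarrow> 'b::{ab_group_add,finite}" and y :: 'b
  assumes "finite (UNIV :: 'c set)" and "surj \<psi>"
    and hom: "\<And>A B. \<psi> (sym_diff A B) = \<psi> A + \<psi> B" and two: "\<And>y::'b. y + y = 0"
  shows "card {V. \<psi> V = y} * CARD('b) = 2 ^ CARD('c)"
proof -
  have *: "card {V. \<psi> V = z} = card {V. \<psi> V = y}" for z
  proof -
    from surjD[OF \<open>surj \<psi>\<close>, of "y + z"] obtain W where W: "\<psi> W = y + z" by auto
    have 1: "y + z + z = y" by (simp add: add.assoc two)
    have 2: "y + z + y = z" by (simp add: add.commute[of y z] add.assoc two)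
    have "bij_betw (sym_diff W) {V. \<psi> V = z} {V. \<psi> V = y}"
      by (rule bij_betw_byWitness[where f' = "sym_diff W"]) (auto simp: hom W 1 2 two)
    then show ?thesis by (rule bij_betw_same_card)
  qed
  have "2 ^ CARD('c) = (\<Sum>V\<in>(UNIV::'c set set). 1::nat)"
    using assms(1) card_Pow[of "UNIV :: 'c set"] by simp
  also have "\<dots> = (\<Sum>z\<in>UNIV. \<Sum>V | V \<in> UNIV \<and> \<psi> V = z. 1)"
    using assms(1) by (intro sum.group[symmetric]) (auto simp: finite_Pow_iff simp flip: Pow_UNIV)
  also have "\<dots> = (\<Sum>z\<in>UNIV. card {V. \<psi> V = z})" by simp
  also have "\<dots> = (\<Sum>z\<in>(UNIV::'b set). card {V. \<psi> V = y})" by (rule sum.cong[OF refl], rule *)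
  finally show ?thesis by (simp add: mult.commute)
qed

instance bit :: finite
proof
  have "(UNIV :: bit set) \<subseteq> {0, 1}" using bit_not_zero_iff by blast
  then show "finite (UNIV :: bit set)" by (rule finite_subset) simp
qed

lemma card_bit: "CARD(bit) = 2"
proof -
  have "(UNIV :: bit set) = {0, 1}" using bit_not_zero_iff by blast
  then have "CARD(bit) = card {0, 1 :: bit}" by (simp only:)
  then show ?thesis by simp
qed

lemma of_nat_bit_eq_0_iff: "(of_nat k :: bit) = 0 \<longleftrightarrow> even k"
  by (induction k) auto

text \<open>The first component records the parity of the size. The image is closed under addition,
  and the points x, y, x + y, with 0 repairing the parity, reach (0, 0, x * y * (x + y)). For y = x
  * z the last entry is x ^ 3 * z * (1 + z); as cubing is onto, a fixed z other than 0 and 1 yields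
  every third component.\<close>

lemma cube_syndromes_surj:
  assumes card: "CARD('f::{field,finite}) = 2 ^ m" "odd m" "m \<ge> 2"
  shows "surj (sum (\<lambda>x::'f. (1::bit, x, x ^ 3)))"
proof -
  have two: "(2::'f) = 0" using card(1) by (rule char_two)
  have two': "y + y = 0" for y :: "bit \<times> 'f \<times> 'f"
    by (cases y) (auto simp: zero_prod_def add_self_eq_0[OF two])
  let ?f = "\<lambda>x::'f. (1::bit, x, x ^ 3)"
  let ?S = "range (sum ?f)"
  have add: "x + y \<in> ?S" if xy: "x \<in> ?S" "y \<in> ?S" for x y
    proof -
    obtain A B where "x = sum ?f A" "y = sum ?f B" using xy by blast
    then have "x + y = sum ?f (sym_diff A B)" by (simp add: sum_sym_diff two')
    then show ?thesis by blast
  qed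
  have f: "?f x \<in> ?S" for x
    using rangeI[of "sum ?f" "{x}"] by simp
  have 1: "(0, x, x ^ 3) \<in> ?S" for x using add[OF f[of x] f[of 0]] by simp
  have 2: "(0, 0, x * y * (x + y)) \<in> ?S" for x y
  proof -
    have eq: "x ^ 3 + y ^ 3 + (x + y) ^ 3 = x * y * (x + y)"
      by (simp add: power3_eq_cube algebra_simps char_two_simps[OF two])
    show ?thesis
      using add[OF add[OF 1[of x] 1[of y]] 1[of "x + y"]] by (simp add: eq add_self_eq_0[OF two])
  qed
  have 3: "(0, 0, b) \<in> ?S" for b
  proof -
    obtain z :: 'f where z: "z \<noteq> 0" "z \<noteq> 1" using ex_not_0_1[OF card(1,3)] by blast
    have "bij (\<lambda>x::'f. x ^ 3)" using inj_cube[OF card(1,2)] by (simp add: bij_def finite_UNIV_inj_surj)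
    then obtain x where x: "x ^ 3 = b / (z * (1 + z))" by (metis bij_pointE)
    have "z * (1 + z) \<noteq> 0" using z add_eq_0_char_two[OF two, of 1 z] by auto
    then have "x * (x * z) * (x + x * z) = b"
      using x by (simp add: power3_eq_cube field_simps)
    then show ?thesis using 2[of x "x * z"] by simp
  qed
  have "(e, a, b) \<in> ?S" for e a b
  proof -
    have "(0, a, b) \<in> ?S"
      using add[OF 1[of a] 3[of "a ^ 3 + b"]] by (simp add: char_two_simps[OF two])
    moreover have "(1, 0, 0) \<in> ?S" using f[of 0] by simp
    ultimately have "(1, a, b) \<in> ?S" using add[of "(1, 0, 0)" "(0, a, b)"] by simp
    then show ?thesis using \<open>(0, a, b) \<in> ?S\<close> by (cases e) auto
  qed
  then show ?thesis by auto
qed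

text \<open>With q the field order, \<open>U\<close> runs over the 2 ^ (q - 1) subsets of even size,
  and each prescribes the syndrome of \<open>V\<close>; all fibres of the syndrome map have 2 ^ q /
  (2 * q ^ 2) elements.\<close>

lemma card_preparata_pairs:
  assumes card: "CARD('f::{field,finite}) = 2 ^ m" "odd m" "m \<ge> 2"
  shows "card {(U, V :: 'f set). preparata_pair U V} * (2 * CARD('f)) ^ 2 = 2 ^ (2 * CARD('f))"
proof -
  let ?q = "CARD('f)"
  have two: "(2::'f) = 0" using card(1) by (rule char_two)
  have two': "y + y = 0" for y :: "bit \<times> 'f \<times> 'f"
    by (cases y) (auto simp: zero_prod_def add_self_eq_0[OF two])
  let ?\<psi> = "sum (\<lambda>x::'f. (1::bit, x, x ^ 3))"
  have \<psi>: "?\<psi> V = (of_nat (card V), (\<Sum>v\<in>V. v), (\<Sum>v\<in>V. v ^ 3))" for V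
    by (intro prod_eqI) (simp_all add: fst_sum snd_sum)
  define K where "K = card {V. ?\<psi> V = 0}"
  have fibre: "card {V. ?\<psi> V = y} * (2 * ?q * ?q) = 2 ^ ?q" for y
    using card_fibres_additive[OF finite cube_syndromes_surj[OF card] sum_sym_diff[OF two' finite finite] two', of y]
    by (simp add: card_prod card_bit)
  have K: "card {V. ?\<psi> V = y} = K" for y
  proof -
    have "card {V. ?\<psi> V = y} * (2 * ?q * ?q) = K * (2 * ?q * ?q)" unfolding K_def by (simp only: fibre)
    then show ?thesis by simp
  qed
  have "{(U, V :: 'f set). preparata_pair U V} =
      (SIGMA U : {U. U \<subseteq> UNIV \<and> even (card U)}. {V. ?\<psi> V = (0, (\<Sum>u\<in>U. u), (\<Sum>u\<in>U. u ^ 3) + (\<Sum>u\<in>U. u) ^ 3)})"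
    by (auto simp: \<psi> preparata_pair_def of_nat_bit_eq_0_iff)
  also have "card \<dots> = (\<Sum>U | U \<subseteq> (UNIV :: 'f set) \<and> even (card U). K)"
    by (subst card_SigmaI) (auto simp: K)
  also have "\<dots> = 2 ^ (?q - 1) * K" using card_odd_subsets(2)[of "UNIV :: 'f set"] by simp
  finally have "card {(U, V :: 'f set). preparata_pair U V} * (2 * ?q) ^ 2 =
      (2 * 2 ^ (?q - 1)) * (K * (2 * ?q * ?q))"
    by (simp add: power2_eq_square)
  also have "K * (2 * ?q * ?q) = 2 ^ ?q" using fibre unfolding K_def by blast
  also have "(2::nat) * 2 ^ (?q - 1) = 2 ^ ?q" by (simp flip: power_Suc)
  finally show ?thesis by (simp add: mult_2 power_add)
qed

section \<open>Hamming distance\<close>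

lemma hamming_dist_zip:
  assumes "length c = length d"
  shows "hamming_dist c d = length (filter (\<lambda>(x, y). x \<noteq> y) (zip c d))"
  using assms by (simp add: hamming_dist_def length_filter_conv_card cong: conj_cong)

lemma hamming_dist_append:
  assumes "length a = length c" "length b = length d"
  shows "hamming_dist (a @ b) (c @ d) = hamming_dist a c + hamming_dist b d"
  using assms by (simp add: hamming_dist_zip)

lemma hamming_dist_map:
  assumes "distinct xs"
  shows "hamming_dist (map f xs) (map g xs) = card {x \<in> set xs. f x \<noteq> g x}"
proof -
  have "hamming_dist (map f xs) (map g xs) = length (filter (\<lambda>x. f x \<noteq> g x) xs)"
    by (induction xs) (simp_all add: hamming_dist_zip)
  also have "\<dots> = card (set (filter (\<lambda>x. f x \<noteq> g x) xs))"
    using assms by (intro distinct_card[symmetric]) simp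
  finally show ?thesis by simp
qed

lemma hamming_weight_dist: "hamming_weight c = hamming_dist c (replicate (length c) 0)"
  unfolding hamming_weight_def hamming_dist_def by (rule arg_cong[where f = card]) auto

context
  fixes fs :: "'f::{field,finite} list"
  assumes fs: "distinct fs" "set fs = UNIV"
begin

definition pair_word :: "'f set \<times> 'f set \<Rightarrow> bit list" where
  "pair_word = (\<lambda>(U, V). map (\<lambda>x. of_bool (x \<in> U)) fs @ map (\<lambda>x. of_bool (x \<in> V)) fs)"

lemma preparata_code_eq: "preparata_code fs = pair_word ` {(U, V). preparata_pair U V}"
  unfolding preparata_code_def pair_word_def preparata_pair_def by auto

lemma length_fs: "length fs = CARD('f)"
  using fs distinct_card[of fs] by simp

lemma length_pair_word: "length (pair_word p) = 2 * CARD('f)"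
  by (simp add: pair_word_def length_fs split: prod.split)

lemma hamming_dist_pair_word:
  "hamming_dist (pair_word (U, V)) (pair_word (U', V')) = card (sym_diff U U') + card (sym_diff V V')"
proof -
  have "{x. (x \<in> A) \<noteq> (x \<in> B)} = sym_diff A B" for A B :: "'f set" by auto
  moreover have "((of_bool P :: bit) \<noteq> of_bool Q) \<longleftrightarrow> P \<noteq> Q" for P Q by auto
  ultimately show ?thesis by (simp add: pair_word_def hamming_dist_append hamming_dist_map fs)
qed

lemma pair_word_empty: "pair_word ({}, {}) = replicate (2 * CARD('f)) 0"
  by (simp add: pair_word_def length_fs map_replicate_const mult_2 replicate_add)

lemma inj_pair_word: "inj pair_word"
proof (rule injI, clarify)
  fix U V U' V' :: "'f set" assume "pair_word (U, V) = pair_word (U', V')"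
  then have "hamming_dist (pair_word (U, V)) (pair_word (U', V')) = 0" by (simp add: hamming_dist_def)
  then show "U = U' \<and> V = V'" by (auto simp: hamming_dist_pair_word)
qed

lemma nearly_perfect_preparata_code:
  assumes card: "CARD('f) = 2 ^ m" "odd m" "m \<ge> 2"
  shows "nearly_perfect {..<2 * CARD('f)} (support ` preparata_code fs)"
proof (rule nearly_perfect_support)
  have two: "(2::'f) = 0" using card(1) by (rule char_two)
  have even: "even (card U)" "even (card V)" if "preparata_pair U V" for U V :: "'f set"
    using that by (auto simp: preparata_pair_def)
  show "length c = 2 * CARD('f)" if "c \<in> preparata_code fs" for c
    using that by (auto simp: preparata_code_eq length_pair_word)
  show "2 * CARD('f) mod 3 = 1" using two_power_mod_3[OF card(2)] card(1) by simp
  have "preparata_pair {} ({} :: 'f set)" by (simp add: preparata_pair_def)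
  then show "replicate (2 * CARD('f)) 0 \<in> preparata_code fs"
    unfolding preparata_code_eq pair_word_empty[symmetric] by (intro imageI) simp
  show "even (hamming_weight c)" if c: "c \<in> preparata_code fs" for c
  proof -
    obtain U V where "c = pair_word (U, V)" "preparata_pair U V" using c by (auto simp: preparata_code_eq)
    then show ?thesis
      using even[of U V]
      by (simp add: hamming_weight_dist length_pair_word pair_word_empty[symmetric] hamming_dist_pair_word)
  qed
  show "6 \<le> hamming_dist c d" if cd: "c \<in> preparata_code fs" "d \<in> preparata_code fs" "c \<noteq> d" for c d
  proof (rule ccontr)
    obtain U V U' V' where c: "c = pair_word (U, V)" "preparata_pair U V"
      and d: "d = pair_word (U', V')" "preparata_pair U' V'" using cd by (auto simp: preparata_code_eq)
    assume "\<not> 6 \<le> hamming_dist c d"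
    then have "card (sym_diff U U') + card (sym_diff V V') < 6"
      by (simp add: c d hamming_dist_pair_word)
    \<comment> \<open>Translation preserves cardinality, so the translated difference is small as
      well.\<close>
    moreover have "card ((+) (\<Sum>u\<in>U. u) ` sym_diff U U') = card (sym_diff U U')" by (rule card_image) simp
    ultimately have "sym_diff U U' = {} \<and> sym_diff V V' = {}"
      using preparata_pair_small[OF card(1,2) preparata_pair_sym_diff[OF two c(2) d(2)]] by simp
    then show False using cd c d by auto
  qed
  have "card (preparata_code fs) = card {(U, V :: 'f set). preparata_pair U V}"
    unfolding preparata_code_eq by (rule card_image, rule inj_on_subset[OF inj_pair_word]) simp
  then show "card (preparata_code fs) * (2 * CARD('f)) ^ 2 = 2 ^ (2 * CARD('f))"
    using card_preparata_pairs[OF card] by simp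
qed

end

section \<open>Witt vectors of length two\<close>

datatype 'a witt2 = Witt2 (wfst: 'a) (wsnd: 'a)

text \<open>The operations make \<^term>\<open>\<lambda>(a, b). a ^ 2 + 2 * b\<close> a ring homomorphism. Over a field of order
  \<^term>\<open>2 ^ m\<close> they give the Galois ring of characteristic 4 with that residue field, and
  \<^term>\<open>Witt2 a 0\<close> is the Teichmueller representative of \<^term>\<open>a\<close>.\<close>

instantiation witt2 :: (comm_ring_1) comm_ring_1
begin

definition "0 = Witt2 0 0"
definition "1 = Witt2 1 0"
definition "x + y = Witt2 (wfst x + wfst y) (wsnd x + wsnd y - wfst x * wfst y)"
definition "x * y = Witt2 (wfst x * wfst y)
  (wfst x ^ 2 * wsnd y + wfst y ^ 2 * wsnd x + 2 * wsnd x * wsnd y)"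
definition "- x = Witt2 (- wfst x) (- wsnd x - wfst x ^ 2)"
definition "x - y = x + - (y :: 'a witt2)"

instance
  by standard
    (auto simp: zero_witt2_def one_witt2_def plus_witt2_def times_witt2_def uminus_witt2_def
      minus_witt2_def power2_eq_square algebra_simps witt2.expand)

end

lemma wfst_simps [simp]:
  "wfst 0 = 0" "wfst 1 = 1" "wfst (x + y) = wfst x + wfst y" "wfst (x * y) = wfst x * wfst y"
  "wfst (- x) = - wfst x" "wfst (x - y) = wfst x - wfst y" "wfst (x ^ k) = wfst x ^ k"
proof -
  show "wfst (x ^ k) = wfst x ^ k"
    by (induction k) (auto simp: one_witt2_def times_witt2_def)
qed (auto simp: zero_witt2_def one_witt2_def plus_witt2_def times_witt2_def uminus_witt2_def minus_witt2_def)

lemma teichmueller_power: "Witt2 a 0 ^ k = Witt2 (a ^ k) 0"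
  by (induction k) (auto simp: one_witt2_def times_witt2_def)

lemma UNIV_witt2: "UNIV = (\<lambda>(a, b). Witt2 a b) ` UNIV"
  by (auto simp: image_iff) (metis witt2.exhaust)

instance witt2 :: (finite) finite
  by standard (subst UNIV_witt2, simp)

lemma card_witt2: "CARD('a::finite witt2) = CARD('a) ^ 2"
proof -
  have "inj (\<lambda>(a, b). Witt2 a (b::'a))" by (auto simp: inj_on_def)
  then have "card ((\<lambda>(a, b). Witt2 a b) ` (UNIV :: ('a \<times> 'a) set)) = CARD('a \<times> 'a)" by (rule card_image)
  then show ?thesis by (simp add: UNIV_witt2[symmetric] power2_eq_square card_prod)
qed

lemma two_witt2:
  assumes "(2::'a::comm_ring_1) = 0"
  shows "(2::'a witt2) = Witt2 0 1" and "(4::'a witt2) = 0"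
proof -
  show 2: "(2::'a witt2) = Witt2 0 1"
    using assms char_two_simps(3)[OF assms, of 1] unfolding one_add_one[symmetric]
    by (simp add: one_witt2_def plus_witt2_def)
  have "(4::'a witt2) = 2 + 2" by simp
  also have "\<dots> = 0" unfolding 2 using assms by (simp add: zero_witt2_def plus_witt2_def)
  finally show "(4::'a witt2) = 0" .
qed

text \<open>Doubling forgets all but the residue \<open>wfst x\<close>; over a field,
  \<open>2 * x\<close> vanishes exactly when this residue does.\<close>

lemma two_times_witt2:
  assumes "(2::'a::comm_ring_1) = 0"
  shows "2 * x = Witt2 0 (wfst x ^ 2 :: 'a)"
  using assms by (simp add: two_witt2[OF assms] times_witt2_def)

section \<open>Ring homomorphisms from the integers modulo 4\<close>

lemma four_cases: "(x::4) = 0 \<or> x = 1 \<or> x = 2 \<or> x = 3"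
proof (cases x)
  case (of_int z)
  then have "z = 0 \<or> z = 1 \<or> z = 2 \<or> z = 3" by auto
  with of_int show ?thesis by auto
qed

lemma ex_of_int_4: "\<exists>k. (x::4) = of_int k"
  by (cases x) auto

locale ring_map =
  fixes f :: "'a::comm_ring_1 \<Rightarrow> 'b::comm_ring_1"
  assumes map_0 [simp]: "f 0 = 0" and map_1 [simp]: "f 1 = 1"
    and map_add [simp]: "f (a + b) = f a + f b" and map_mult [simp]: "f (a * b) = f a * f b"
begin

definition eval_map :: "'b \<Rightarrow> 'a poly \<Rightarrow> 'b" where
  "eval_map x p = poly (map_poly f p) x"

lemma map_poly_add: "map_poly f (p + q) = map_poly f p + map_poly f q"
  by (rule poly_eqI) (simp add: coeff_map_poly)

lemma map_uminus: "f (- a) = - f a"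
  using map_add[of a "- a"] by (simp add: eq_neg_iff_add_eq_0 add.commute)

lemma map_poly_uminus: "map_poly f (- p) = - map_poly f p"
  by (rule poly_eqI) (simp add: coeff_map_poly map_uminus)

lemma map_poly_diff: "map_poly f (p - q) = map_poly f p - map_poly f q"
  using map_poly_add[of "p - q" q] by (simp add: eq_diff_eq)

lemma map_poly_mult: "map_poly f (p * q) = map_poly f p * map_poly f q"
proof (induction p)
  case (pCons a p)
  have "map_poly f (pCons a p * q) = map_poly f (smult a q) + map_poly f (pCons 0 (p * q))"
    by (simp add: map_poly_add)
  also have "map_poly f (smult a q) = smult (f a) (map_poly f q)"
    by (rule poly_eqI) (simp add: coeff_map_poly)
  also have "map_poly f (pCons 0 (p * q)) = pCons 0 (map_poly f p * map_poly f q)"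
    by (simp add: map_poly_pCons pCons)
  finally show ?case by (simp add: map_poly_pCons)
qed simp

lemma eval_map_simps [simp]:
  "eval_map x 0 = 0" "eval_map x 1 = 1" "eval_map x (pCons a p) = f a + x * eval_map x p"
  "eval_map x (p + q) = eval_map x p + eval_map x q" "eval_map x (- p) = - eval_map x p"
  "eval_map x (p - q) = eval_map x p - eval_map x q" "eval_map x (p * q) = eval_map x p * eval_map x q"
  "eval_map x (smult a p) = f a * eval_map x p" "eval_map x (monom a k) = f a * x ^ k"
proof -
  show mult: "eval_map x (p * q) = eval_map x p * eval_map x q" for p q
    by (simp add: eval_map_def map_poly_mult)
  show pc: "eval_map x (pCons a p) = f a + x * eval_map x p" for a p
    by (simp add: eval_map_def map_poly_pCons)
  have "smult a p = pCons a 0 * p" by simp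
  then show "eval_map x (smult a p) = f a * eval_map x p"
    by (metis mult pc eval_map_def map_poly_0 poly_0 mult_zero_right add.right_neutral)
  show "eval_map x (p - q) = eval_map x p - eval_map x q"
    by (simp add: eval_map_def map_poly_diff)
qed (simp_all add: eval_map_def map_poly_add map_poly_uminus map_poly_monom poly_monom)

end

text \<open>Given by its four values, it is defined for every target ring, and it is the canonical
  homomorphism as soon as 4 = 0 there.\<close>

definition z4_map :: "4 \<Rightarrow> 'a::comm_ring_1" where
  "z4_map a = (if a = 0 then 0 else if a = 1 then 1 else if a = 2 then 2 else 3)"

lemma z4_map_of_int:
  assumes "(4::'a::comm_ring_1) = 0"
  shows "z4_map (of_int k) = (of_int k :: 'a)"
proof -
  have "(of_int k :: 4) = of_int (k mod 4)" by (simp add: bit0.of_int_eq)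
  moreover have "(of_int k :: 'a) = of_int (k mod 4)"
  proof -
    have "(of_int k :: 'a) = of_int (4 * (k div 4) + k mod 4)" by simp
    also have "\<dots> = of_int (k mod 4)" by (simp only: of_int_add of_int_mult) (simp add: assms)
    finally show ?thesis .
  qed
  moreover have "k mod 4 = 0 \<or> k mod 4 = 1 \<or> k mod 4 = 2 \<or> k mod 4 = 3" by presburger
  ultimately show ?thesis by (auto simp: z4_map_def)
qed

lemma ring_map_z4_map:
  assumes "(4::'a::comm_ring_1) = 0"
  shows "ring_map (z4_map :: 4 \<Rightarrow> 'a)"
proof
  fix a b :: 4
  obtain i j where ij: "a = of_int i" "b = of_int j" using ex_of_int_4 by metis
  show "(z4_map (a + b) :: 'a) = z4_map a + z4_map b"
    using z4_map_of_int[OF assms, of "i + j"] by (simp add: ij z4_map_of_int[OF assms])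
  show "(z4_map (a * b) :: 'a) = z4_map a * z4_map b"
    using z4_map_of_int[OF assms, of "i * j"] by (simp add: ij z4_map_of_int[OF assms])
qed (simp_all add: z4_map_def)

lemma ring_map_red2: "ring_map red2"
proof
  fix a b :: 4
  obtain i j where ij: "a = of_int i" "b = of_int j" using ex_of_int_4 by metis
  show "red2 (a + b) = red2 a + red2 b"
    using red2_of_int[of "i + j"] by (simp add: ij red2_of_int)
  show "red2 (a * b) = red2 a * red2 b"
    using red2_of_int[of "i * j"] by (simp add: ij red2_of_int)
qed (simp_all add: red2_def)

lemma ring_map_embed_bit:
  assumes "(2::'f::field) = 0"
  shows "ring_map (embed_bit :: bit \<Rightarrow> 'f)"
  by standard (use add_self_eq_0[OF assms, of 1] in \<open>auto simp: embed_bit_def assms\<close>)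

lemma wfst_z4_map:
  assumes "(2::'f::field) = 0"
  shows "wfst (z4_map a :: 'f witt2) = embed_bit (red2 a)"
proof -
  have "wfst (2 :: 'f witt2) = 0" using assms by (simp add: two_witt2)
  moreover have "wfst (3 :: 'f witt2) = 1"
  proof -
    have "(3 :: 'f witt2) = 2 + 1" by simp
    then show ?thesis using calculation by (simp only: wfst_simps) simp
  qed
  ultimately show ?thesis using four_cases[of a] by (auto simp: z4_map_def red2_def embed_bit_def)
qed

section \<open>Polynomials\<close>

text \<open>Bounding the degree through coefficients lets the zero polynomial take part, also for
  \<open>k = 0\<close>.\<close>

lemma card_bounded_polys:
  "card {p :: 'a::{comm_ring_1,finite} poly. \<forall>i\<ge>k. coeff p i = 0} = CARD('a) ^ k"
proof (induction k)
  case 0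
  have "{p :: 'a poly. \<forall>i\<ge>0. coeff p i = 0} = {0}" by (auto intro: poly_eqI)
  then show ?case by simp
next
  case (Suc k)
  let ?S = "\<lambda>k. {p :: 'a poly. \<forall>i\<ge>k. coeff p i = 0}"
  have "?S (Suc k) = (\<lambda>(a, p). pCons a p) ` (UNIV \<times> ?S k)"
  proof (intro equalityI subsetI)
    fix p :: "'a poly" assume p: "p \<in> ?S (Suc k)"
    obtain a q where "p = pCons a q" by (cases p)
    moreover from this have "q \<in> ?S k" using p by (auto simp: coeff_pCons split: nat.splits)
    ultimately show "p \<in> (\<lambda>(a, p). pCons a p) ` (UNIV \<times> ?S k)" by auto
  qed (auto simp: coeff_pCons split: nat.splits)
  moreover have "inj_on (\<lambda>(a, p). pCons a p) (UNIV \<times> ?S k)" by (auto simp: inj_on_def)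
  ultimately have "card (?S (Suc k)) = card ((UNIV :: 'a set) \<times> ?S k)" by (simp only: card_image)
  then show ?case using Suc by (simp only: card_cartesian_product) simp
qed

text \<open>Pseudo-division multiplies the dividend by a power of the leading coefficient, here 1,
  so division with remainder survives zero divisors.\<close>

lemma monic_division:
  fixes h p :: "'a::comm_ring_1 poly"
  assumes "lead_coeff h = 1"
  obtains q r where "p = h * q + r" "r = 0 \<or> degree r < degree h"
proof -
  have "h \<noteq> 0" using assms by auto
  then show ?thesis using pseudo_divmod[of h p] that assms
    by (metis power_one smult_1_left surj_pair)
qed

lemma monic_mult_eq_0:
  fixes h p :: "'a::comm_ring_1 poly"
  assumes "lead_coeff h = 1" "h * p = 0"
  shows "p = 0"
  using coeff_mult_degree_sum[of h p] assms by simp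

lemma geometric_sum_poly: "[:-1, 1:] * (\<Sum>i<k. monom 1 i) = monom 1 k - (1 :: 'a::comm_ring_1 poly)"
proof (induction k)
  case (Suc k)
  then show ?case by (simp add: distrib_left monom_Suc)
qed simp

section \<open>Duals of cyclic codes\<close>

text \<open>For positive \<open>n\<close>, the constant coefficient of the class of \<open>p\<close>
  modulo X ^ n - 1 (see \<open>periodic_coeff_dvd\<close>). Through this functional, inner products
  of words become products of polynomials.\<close>

definition periodic_coeff :: "nat \<Rightarrow> 'a::comm_ring_1 poly \<Rightarrow> 'a" where
  "periodic_coeff n p = (\<Sum>i\<le>degree p. if n dvd i then coeff p i else 0)"

lemma periodic_coeff_bound:
  assumes "degree p \<le> N"
  shows "periodic_coeff n p = (\<Sum>i\<le>N. if n dvd i then coeff p i else 0)"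
  unfolding periodic_coeff_def
  by (rule sum.mono_neutral_left) (use assms in \<open>auto simp: coeff_eq_0\<close>)

lemma periodic_coeff_0 [simp]: "periodic_coeff n 0 = 0"
  by (simp add: periodic_coeff_def)

lemma periodic_coeff_add: "periodic_coeff n (p + q) = periodic_coeff n p + periodic_coeff n q"
proof -
  let ?N = "max (degree p) (degree q)"
  have "degree p \<le> ?N" "degree q \<le> ?N" "degree (p + q) \<le> ?N" by (auto intro: degree_add_le)
  note * = this[THEN periodic_coeff_bound]
  show ?thesis unfolding * by (simp add: sum.distrib[symmetric] if_distrib cong: if_cong sum.cong)
qed

lemma periodic_coeff_sum: "periodic_coeff n (sum f A) = (\<Sum>x\<in>A. periodic_coeff n (f x))"
  by (induction A rule: infinite_finite_induct) (auto simp: periodic_coeff_add)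

lemma periodic_coeff_monom: "periodic_coeff n (monom a i) = (if n dvd i then a else 0)"
proof -
  have "periodic_coeff n (monom a i) = (\<Sum>j\<le>i. if n dvd j then coeff (monom a i) j else 0)"
    by (rule periodic_coeff_bound) (rule degree_monom_le)
  also have "\<dots> = (\<Sum>j\<le>i. if j = i then (if n dvd i then a else 0) else 0)"
    by (rule sum.cong) auto
  finally show ?thesis by simp
qed

lemma periodic_coeff_shift: "periodic_coeff n (monom 1 n * p) = periodic_coeff n p"
proof -
  have "monom 1 n * p = monom 1 n * (\<Sum>i\<le>degree p. monom (coeff p i) i)"
    by (simp only: poly_as_sum_of_monoms)
  also have "\<dots> = (\<Sum>i\<le>degree p. monom (coeff p i) (n + i))" by (simp add: sum_distrib_left mult_monom)
  also have "periodic_coeff n \<dots> = periodic_coeff n p"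
    unfolding periodic_coeff_sum periodic_coeff_monom periodic_coeff_def[of n p] by simp
  finally show ?thesis .
qed

lemma periodic_coeff_dvd:
  assumes "monom 1 n - 1 dvd p - q"
  shows "periodic_coeff n p = periodic_coeff n q"
proof -
  obtain t where "p - q = (monom 1 n - 1) * t" using assms by (elim dvdE)
  then have "p + t = monom 1 n * t + q" by (simp add: algebra_simps)
  then have "periodic_coeff n p + periodic_coeff n t = periodic_coeff n t + periodic_coeff n q"
    by (metis periodic_coeff_add periodic_coeff_shift)
  then show ?thesis by simp
qed

text \<open>The substitution of \<^term>\<open>X ^ (n - 1)\<close>, which is the inverse of \<^term>\<open>X\<close> modulo \<^term>\<open>X ^ n - 1\<close>.\<close>

definition invert_var :: "nat \<Rightarrow> 'a::comm_ring_1 poly \<Rightarrow> 'a poly" where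
  "invert_var n p = pcompose p (monom 1 (n - 1))"

lemma invert_var_mult: "invert_var n (p * q) = invert_var n p * invert_var n q"
  by (simp add: invert_var_def pcompose_mult)

lemma invert_var_monom: "invert_var n (monom a i) = monom a ((n - 1) * i)"
proof (induction i)
  case (Suc i)
  then show ?case by (simp add: invert_var_def monom_Suc pcompose_pCons mult_monom)
qed (simp add: invert_var_def monom_0)

lemma invert_var_sum: "invert_var n (sum f A) = (\<Sum>x\<in>A. invert_var n (f x))"
  by (simp add: invert_var_def pcompose_sum)

lemma monom_minus_1_dvd: "monom 1 n - 1 dvd monom 1 (n * k) - (1 :: 'a::comm_ring_1 poly)"
proof (induction k)
  case (Suc k)
  have "monom 1 (n * Suc k) - (1 :: 'a poly) = monom 1 n * (monom 1 (n * k) - 1) + (monom 1 n - 1)"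
    by (simp add: algebra_simps mult_monom)
  then show ?case using Suc by (simp only: dvd_add dvd_mult dvd_refl)
qed simp

lemma monic_monom_minus_1:
  assumes "n > 0"
  shows "degree (monom 1 n - 1 :: 'a::comm_ring_1 poly) = n" "lead_coeff (monom 1 n - 1 :: 'a poly) = 1"
proof -
  have "degree (monom 1 n + (-1) :: 'a poly) = degree (monom 1 n :: 'a poly)"
    by (rule degree_add_eq_left) (use assms in \<open>simp add: degree_monom_eq\<close>)
  then show "degree (monom 1 n - 1 :: 'a poly) = n" by (simp add: degree_monom_eq)
  then show "lead_coeff (monom 1 n - 1 :: 'a poly) = 1" using assms by simp
qed

lemma invert_var_dvd:
  fixes w :: "'a::comm_ring_1 poly"
  assumes "n > 0" "monom 1 n - 1 dvd w"
  shows "monom 1 n - 1 dvd invert_var n w"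
proof -
  obtain t where "w = (monom 1 n - 1) * t" using assms by (elim dvdE)
  moreover have "invert_var n (monom 1 n - 1 :: 'a poly) = monom 1 (n * (n - 1)) - 1"
    unfolding mult.commute[of n] invert_var_monom[symmetric] by (simp add: invert_var_def pcompose_diff pcompose_1)
  ultimately have "invert_var n w = (monom 1 (n * (n - 1)) - 1) * invert_var n t"
    by (simp only: invert_var_mult)
  then show ?thesis using monom_minus_1_dvd[of n "n - 1"] by (metis dvd_mult2)
qed

lemma poly_eq_sum_monom:
  assumes "\<And>i. i \<ge> n \<Longrightarrow> coeff p i = 0"
  shows "p = (\<Sum>i<n. monom (coeff p i) i)"
  by (rule poly_eqI) (use assms in \<open>auto simp: coeff_sum not_less\<close>)

text \<open>Modulo \<open>n\<close>, the exponent \<open>i + (n - 1) * k\<close> is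
  \<open>i - k\<close>, so only the terms with \<open>i = k\<close> reach the constant
  coefficient.\<close>

lemma periodic_coeff_inner:
  fixes p q :: "'a::comm_ring_1 poly"
  assumes "n > 0" "\<And>i. i \<ge> n \<Longrightarrow> coeff p i = 0" "\<And>i. i \<ge> n \<Longrightarrow> coeff q i = 0"
  shows "periodic_coeff n (p * invert_var n q) = (\<Sum>i<n. coeff p i * coeff q i)"
proof -
  have dvd: "n dvd i + (n - 1) * k \<longleftrightarrow> k = i" if "i < n" "k < n" for i k
  proof
    assume "n dvd i + (n - 1) * k"
    then obtain l where "i + (n - 1) * k = n * l" by (elim dvdE)
    moreover have "(n - 1) * k + k = n * k" using assms(1) by (cases n) auto
    ultimately have "i + n * k = k + n * l" by simp
    then show "k = i" using that by (metis mod_less mod_mult_self2)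
  next
    assume "k = i"
    then have "i + (n - 1) * k = n * i" using assms(1) by (cases n) auto
    then show "n dvd i + (n - 1) * k" by simp
  qed
  have "p * invert_var n q = (\<Sum>i<n. monom (coeff p i) i) * invert_var n (\<Sum>k<n. monom (coeff q k) k)"
    using poly_eq_sum_monom[of n p] poly_eq_sum_monom[of n q] assms(2,3) by simp
  also have "\<dots> = (\<Sum>i<n. \<Sum>k<n. monom (coeff p i * coeff q k) (i + (n - 1) * k))"
    by (simp add: invert_var_sum invert_var_monom sum_product mult_monom)
  finally have "periodic_coeff n (p * invert_var n q) =
      (\<Sum>i<n. \<Sum>k<n. if n dvd i + (n - 1) * k then coeff p i * coeff q k else 0)"
    by (simp add: periodic_coeff_sum periodic_coeff_monom)
  also have "\<dots> = (\<Sum>i<n. \<Sum>k<n. if k = i then coeff p i * coeff q k else 0)"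
  proof (intro sum.cong refl)
    fix i k assume "i \<in> {..<n}" "k \<in> {..<n}"
    then show "(if n dvd i + (n - 1) * k then coeff p i * coeff q k else 0) =
        (if k = i then coeff p i * coeff q k else 0)"
      using dvd[of i k] by (simp only: lessThan_iff)
  qed
  finally show ?thesis by simp
qed

text \<open>Nondegeneracy of the pairing: testing against X ^ j reads off coefficient j of the
  remainder of \<open>w\<close>.\<close>

lemma dvd_if_periodic_coeff:
  fixes w :: "'a::comm_ring_1 poly"
  assumes n: "n > 0" and zero: "\<And>i. periodic_coeff n (monom 1 i * invert_var n w) = 0"
  shows "monom 1 n - 1 dvd w"
proof -
  obtain q r where qr: "w = (monom 1 n - 1) * q + r" "r = 0 \<or> degree r < n"
    using monic_division[OF monic_monom_minus_1(2)[OF n], of w]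
    unfolding monic_monom_minus_1(1)[OF n] by blast
  have r: "coeff r i = 0" if "i \<ge> n" for i using qr(2) that by (auto simp: coeff_eq_0)
  have "coeff r j = 0" if "j < n" for j
  proof -
    have "monom 1 n - 1 dvd w - r" using qr by simp
    from invert_var_dvd[OF n this] have "monom 1 n - 1 dvd invert_var n w - invert_var n r"
      by (simp add: invert_var_def pcompose_diff)
    then have "monom 1 n - 1 dvd monom 1 j * invert_var n w - monom 1 j * invert_var n r"
      by (metis dvd_mult right_diff_distrib)
    then have "periodic_coeff n (monom 1 j * invert_var n r) = 0"
      using periodic_coeff_dvd zero by metis
    moreover have "periodic_coeff n (monom 1 j * invert_var n r) = (\<Sum>i<n. coeff (monom 1 j) i * coeff r i)"
      by (rule periodic_coeff_inner) (use n r that in auto)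
    moreover have "\<dots> = (\<Sum>i<n. if i = j then coeff r i else 0)" by (rule sum.cong) auto
    ultimately show ?thesis using that by simp
  qed
  then have "r = 0" using r by (intro poly_eqI) (metis coeff_0 not_less)
  then show ?thesis using qr by simp
qed

text \<open>Modulo X ^ n - 1, the reciprocal polynomial differs from \<open>v\<close> at the inverse
  of X only by a power of X, which is a unit.\<close>

lemma reflect_poly_invert_var:
  fixes v :: "'a::comm_ring_1 poly"
  assumes "n > 0"
  shows "monom 1 n - 1 dvd monom 1 (degree v) * invert_var n v - reflect_poly v"
proof -
  let ?d = "degree v"
  have "reflect_poly v = (\<Sum>i\<le>?d. monom (coeff v i) (?d - i))"
  proof (rule poly_eqI)
    fix k
    have "(\<Sum>i\<le>?d. coeff (monom (coeff v i) (?d - i)) k) =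
        (\<Sum>i\<le>?d. if i = ?d - k then (if k \<le> ?d then coeff v i else 0) else 0)"
      by (rule sum.cong) auto
    then show "coeff (reflect_poly v) k = coeff (\<Sum>i\<le>?d. monom (coeff v i) (?d - i)) k"
      by (simp add: coeff_sum coeff_reflect_poly)
  qed
  moreover have "invert_var n v = (\<Sum>i\<le>?d. monom (coeff v i) ((n - 1) * i))"
    by (subst poly_as_sum_of_monoms[of v, symmetric]) (simp add: invert_var_sum invert_var_monom)
  ultimately have "monom 1 ?d * invert_var n v - reflect_poly v =
      (\<Sum>i\<le>?d. monom (coeff v i) (?d + (n - 1) * i) - monom (coeff v i) (?d - i))"
    by (simp add: sum_distrib_left mult_monom sum_subtractf)
  also have "\<dots> = (\<Sum>i\<le>?d. monom (coeff v i) (?d - i) * (monom 1 (n * i) - 1))"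
  proof (rule sum.cong)
    fix i assume "i \<in> {..?d}"
    moreover have "(n - 1) * i + i = n * i" using assms by (cases n) auto
    ultimately have "?d + (n - 1) * i = (?d - i) + n * i" by simp
    then show "monom (coeff v i) (?d + (n - 1) * i) - monom (coeff v i) (?d - i) =
        monom (coeff v i) (?d - i) * (monom 1 (n * i) - 1)"
      by (simp add: algebra_simps mult_monom)
  qed simp
  finally show ?thesis using monom_minus_1_dvd[of n] by (auto intro!: dvd_sum dvd_mult)
qed

lemma ex_word:
  fixes p :: "'a::comm_ring_1 poly"
  assumes n: "n > 0"
  obtains c where "length c = n" "monom 1 n - 1 dvd Poly c - p"
proof -
  obtain q r where qr: "p = (monom 1 n - 1) * q + r" "r = 0 \<or> degree r < n"
    using monic_division[OF monic_monom_minus_1(2)[OF n], of p]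
    unfolding monic_monom_minus_1(1)[OF n] by blast
  have "Poly (map (coeff r) [0..<n]) = r"
    using qr(2) by (intro poly_eqI) (auto simp: nth_default_def coeff_eq_0)
  moreover have "r - p = (monom 1 n - 1) * (- q)" using qr(1) by simp
  ultimately show ?thesis using that[of "map (coeff r) [0..<n]"] by simp
qed

lemma cyclic_code_dvd:
  assumes "u dvd monom 1 n - 1"
  shows "cyclic_code n u = {c. length c = n \<and> u dvd Poly c}"
proof -
  have "(\<exists>a. monom 1 n - 1 dvd p - a * u) \<longleftrightarrow> u dvd p" for p
  proof
    assume "\<exists>a. monom 1 n - 1 dvd p - a * u"
    then obtain a where "u dvd p - a * u" using assms dvd_trans by blast
    then have "u dvd (p - a * u) + a * u" by (intro dvd_add) auto
    then show "u dvd p" by simp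
  next
    assume "u dvd p"
    then obtain a where "p = a * u" by (metis dvdE mult.commute)
    then show "\<exists>a. monom 1 n - 1 dvd p - a * u" by (intro exI[of _ a]) simp
  qed
  then show ?thesis by (simp add: cyclic_code_def)
qed

text \<open>Orthogonality to every multiple of the reciprocal of \<open>v\<close> says that X ^ i
  times the inverted \<open>v * Poly d\<close> has constant coefficient 0 for all i, that is, X ^ n
  - 1 divides \<open>v * Poly d\<close>. Cancelling against \<open>u * v\<close> leaves
  \<open>u dvd Poly d\<close>.\<close>

lemma dual_cyclic_code:
  fixes u v :: "'a::comm_ring_1 poly"
  assumes n: "n > 0" and uv: "u * v = monom 1 n - 1"
  shows "dual_code n (cyclic_code n (reflect_poly v)) = cyclic_code n u"
proof -
  have inner: "(\<Sum>i<n. c ! i * d ! i) = periodic_coeff n (Poly c * invert_var n (Poly d))"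
    if "length c = n" "length d = n" for c d :: "'a list"
    using periodic_coeff_inner[OF n, of "Poly c" "Poly d"] that by (simp add: nth_default_def)
  have word: "periodic_coeff n (Poly c * invert_var n (Poly d)) =
      periodic_coeff n (a * monom 1 (degree v) * invert_var n (v * Poly d))"
    if "monom 1 n - 1 dvd Poly c - a * reflect_poly v" for a and c d :: "'a list"
  proof (rule periodic_coeff_dvd)
    have "Poly c * invert_var n (Poly d) - a * monom 1 (degree v) * invert_var n (v * Poly d) =
      (Poly c - a * reflect_poly v) * invert_var n (Poly d) -
      (monom 1 (degree v) * invert_var n v - reflect_poly v) * (a * invert_var n (Poly d))"
      by (simp add: invert_var_mult algebra_simps)
    then show "monom 1 n - 1 dvd Poly c * invert_var n (Poly d) -
        a * monom 1 (degree v) * invert_var n (v * Poly d)"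
      using that reflect_poly_invert_var[OF n, of v] by (simp add: dvd_diff)
  qed
  have "d \<in> dual_code n (cyclic_code n (reflect_poly v)) \<longleftrightarrow> u dvd Poly d" if d: "length d = n" for d
  proof
    assume dual: "d \<in> dual_code n (cyclic_code n (reflect_poly v))"
    have "monom 1 n - 1 dvd v * Poly d"
    proof (rule dvd_if_periodic_coeff[OF n])
      fix i
      \<comment> \<open>Apart from X ^ i, the exponent completes the X ^ degree v of the reciprocal
        to X ^ (n * degree v), which is 1 modulo X ^ n - 1.\<close>
      define a where "a = monom (1::'a) (i + (n - 1) * degree v)"
      obtain c where c: "length c = n" "monom 1 n - 1 dvd Poly c - a * reflect_poly v"
        using ex_word[OF n] by metis
      then have "c \<in> cyclic_code n (reflect_poly v)" by (auto simp: cyclic_code_def)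
      then have "(\<Sum>i<n. c ! i * d ! i) = 0" using dual by (auto simp: dual_code_def)
      then have "periodic_coeff n (a * monom 1 (degree v) * invert_var n (v * Poly d)) = 0"
        using inner[OF c(1) d] word[OF c(2)] by simp
      moreover have "(n - 1) * degree v + degree v = n * degree v" using n by (cases n) auto
      then have "a * monom 1 (degree v) = monom 1 i * monom 1 (n * degree v)"
        by (simp add: a_def mult_monom add.assoc)
      moreover have "periodic_coeff n (monom 1 i * monom 1 (n * degree v) * invert_var n (v * Poly d)) =
          periodic_coeff n (monom 1 i * invert_var n (v * Poly d))"
      proof (rule periodic_coeff_dvd)
        have "monom 1 i * monom 1 (n * degree v) * invert_var n (v * Poly d) - monom 1 i * invert_var n (v * Poly d) =
            (monom 1 (n * degree v) - 1) * (monom 1 i * invert_var n (v * Poly d))"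
          by (simp add: algebra_simps)
        then show "monom 1 n - 1 dvd monom 1 i * monom 1 (n * degree v) * invert_var n (v * Poly d) -
            monom 1 i * invert_var n (v * Poly d)"
          using monom_minus_1_dvd[of n "degree v"] by (metis dvd_mult2)
      qed
      ultimately show "periodic_coeff n (monom 1 i * invert_var n (v * Poly d)) = 0" by simp
    qed
    then obtain t where "v * Poly d = u * v * t" unfolding uv by (elim dvdE)
    \<comment> \<open>Multiplying by \<open>u\<close> brings in the monic \<open>u * v\<close>,
      which can be cancelled, whereas \<open>v\<close> might be a zero divisor.\<close>
    then have "u * (v * Poly d) = u * (u * v * t)" by simp
    then have "(monom 1 n - 1) * (Poly d - u * t) = 0" unfolding uv[symmetric] by (simp add: algebra_simps)
    then have "Poly d - u * t = 0" by (rule monic_mult_eq_0[OF monic_monom_minus_1(2)[OF n]])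
    then show "u dvd Poly d" by simp
  next
    assume "u dvd Poly d"
    then have "monom 1 n - 1 dvd v * Poly d" unfolding uv[symmetric] by (metis mult.commute mult_dvd_mono dvd_refl)
    then have w: "monom 1 n - 1 dvd invert_var n (v * Poly d)" by (rule invert_var_dvd[OF n])
    have "(\<Sum>i<n. c ! i * d ! i) = 0" if c: "c \<in> cyclic_code n (reflect_poly v)" for c
    proof -
      obtain a where a: "length c = n" "monom 1 n - 1 dvd Poly c - a * reflect_poly v"
        using c by (auto simp: cyclic_code_def)
      have "periodic_coeff n (a * monom 1 (degree v) * invert_var n (v * Poly d)) = periodic_coeff n 0"
        by (rule periodic_coeff_dvd) (use w in simp)
      then show ?thesis using inner[OF a(1) d] word[OF a(2)] by simp
    qed
    then show "d \<in> dual_code n (cyclic_code n (reflect_poly v))" using d by (auto simp: dual_code_def)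
  qed
  moreover have "cyclic_code n u = {c. length c = n \<and> u dvd Poly c}"
    by (rule cyclic_code_dvd) (simp flip: uv)
  moreover have "length d = n" if "d \<in> dual_code n C" for d :: "'a list" and C
    using that by (simp add: dual_code_def)
  ultimately show ?thesis by blast
qed

section \<open>Codes extended by a parity check\<close>

lemma parity_extend_iff:
  assumes "length b = Suc n"
  shows "b \<in> parity_extend ` {c. length c = n \<and> P c} \<longleftrightarrow> P (take n b) \<and> sum_list b = 0"
proof -
  have b: "b = take n b @ [b ! n]" using assms by (metis lessI order_refl take_Suc_conv_app_nth take_all)
  show ?thesis
  proof
    assume "b \<in> parity_extend ` {c. length c = n \<and> P c}"
    then show "P (take n b) \<and> sum_list b = 0" by (auto simp: parity_extend_def)
  next
    assume *: "P (take n b) \<and> sum_list b = 0"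
    have "sum_list (take n b) + b ! n = 0" using * by (subst (asm) b) simp
    then have "b = parity_extend (take n b)" by (subst b) (simp add: parity_extend_def eq_neg_iff_add_eq_0 add.commute)
    then show "b \<in> parity_extend ` {c. length c = n \<and> P c}" using * assms by (intro image_eqI) auto
  qed
qed

text \<open>Subtracting the last coordinate from all others reduces the dual of an extended code to the
  dual of the code itself.\<close>

lemma dual_parity_extend:
  fixes C :: "'a::comm_ring_1 list set"
  assumes b: "length b = Suc n" and C: "\<And>c. c \<in> C \<Longrightarrow> length c = n"
  shows "b \<in> dual_code (Suc n) (parity_extend ` C) \<longleftrightarrow>
    map (\<lambda>i. b ! i - b ! n) [0..<n] \<in> dual_code n C"
proof -
  have "(\<Sum>i<Suc n. parity_extend c ! i * b ! i) = (\<Sum>i<n. c ! i * (map (\<lambda>i. b ! i - b ! n) [0..<n]) ! i)"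
    if "c \<in> C" for c
  proof -
    have "sum_list c = (\<Sum>i<n. c ! i)" using C[OF that] by (simp add: sum_list_sum_nth lessThan_atLeast0)
    then show ?thesis
      using C[OF that] by (simp add: parity_extend_def nth_append sum_distrib_left sum_subtractf algebra_simps)
  qed
  then show ?thesis using b by (simp add: dual_code_def)
qed

text \<open>Subtracting the last coordinate from all others subtracts a multiple of \<Phi> = 1 + X +
  ... + X ^ (n - 1). Divisibility by \<open>h\<close> is unaffected because h * q = \<Phi>; the
  value at 1 becomes P(1) plus that coordinate because \<Phi>(1) = n = -1. So the factor X - 1 is
  precisely the parity check.\<close>

lemma dual_extended_cyclic_code:
  fixes h q :: "'a::comm_ring_1 poly"
  assumes n: "of_nat n = (-1 :: 'a)" "n > 0" and hq: "[:-1, 1:] * h * q = monom 1 n - 1"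
    and h: "lead_coeff h = 1"
  shows "dual_code (Suc n) (parity_extend ` cyclic_code n (reflect_poly q)) = parity_extend ` cyclic_code n h"
proof -
  define \<Phi> :: "'a poly" where "\<Phi> = (\<Sum>i<n. monom 1 i)"
  have X: "[:-1, 1:] * \<Phi> = monom 1 n - 1" unfolding \<Phi>_def by (rule geometric_sum_poly)
  have "[:-1, 1:] * (h * q - \<Phi>) = 0" using X hq by (simp only: right_diff_distrib mult.assoc[symmetric]) simp
  moreover have "lead_coeff [:-1, 1 :: 'a:] = 1" by simp
  ultimately have "h * q - \<Phi> = 0" using monic_mult_eq_0 by blast
  then have hq\<Phi>: "h * q = \<Phi>" by simp
  have \<Phi>1: "poly \<Phi> 1 = -1" using n by (simp add: \<Phi>_def poly_sum poly_monom)
  have "b \<in> dual_code (Suc n) (parity_extend ` cyclic_code n (reflect_poly q)) \<longleftrightarrow>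
      b \<in> parity_extend ` cyclic_code n h" if b: "length b = Suc n" for b
  proof -
    define P where "P = Poly (take n b)"
    define d where "d = map (\<lambda>i. b ! i - b ! n) [0..<n]"
    have Pd: "Poly d = P - smult (b ! n) \<Phi>"
      using b by (intro poly_eqI) (auto simp: d_def P_def \<Phi>_def nth_default_def coeff_sum)
    have P1: "poly P 1 = sum_list (take n b)"
    proof -
      have "poly (Poly xs) 1 = sum_list xs" for xs :: "'a list" by (induction xs) auto
      then show ?thesis by (simp add: P_def)
    qed
    have "take n b @ [b ! n] = b" using b by (metis lessI order_refl take_Suc_conv_app_nth take_all)
    then have sum: "sum_list b = poly P 1 + b ! n" by (metis P1 sum_list.append sum_list_simps(2) sum_list.Nil add.right_neutral)
    have "b \<in> dual_code (Suc n) (parity_extend ` cyclic_code n (reflect_poly q)) \<longleftrightarrow>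
        d \<in> dual_code n (cyclic_code n (reflect_poly q))"
      unfolding d_def by (rule dual_parity_extend[OF b]) (simp add: cyclic_code_def)
    also have "\<dots> \<longleftrightarrow> [:-1, 1:] * h dvd Poly d"
      unfolding dual_cyclic_code[OF n(2) hq]
      by (subst cyclic_code_dvd) (simp_all add: d_def flip: hq)
    also have "\<dots> \<longleftrightarrow> h dvd P \<and> poly P 1 + b ! n = 0"
    proof
      assume *: "[:-1, 1:] * h dvd Poly d"
      then have "h dvd Poly d" by (rule dvd_mult_right)
      then have "h dvd Poly d + smult (b ! n) \<Phi>" by (intro dvd_add dvd_smult) (simp_all flip: hq\<Phi>)
      moreover have "[:-1, 1:] dvd Poly d" using * by (rule dvd_mult_left)
      then have "poly (Poly d) 1 = 0" by (simp add: poly_eq_0_iff_dvd)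
      ultimately show "h dvd P \<and> poly P 1 + b ! n = 0" by (simp add: Pd \<Phi>1)
    next
      assume *: "h dvd P \<and> poly P 1 + b ! n = 0"
      then have "h dvd Poly d" unfolding Pd by (intro dvd_diff dvd_smult) (simp_all flip: hq\<Phi>)
      then obtain a where a: "Poly d = h * a" by (elim dvdE)
      have "poly (Poly d) 1 = 0" using * by (simp add: Pd \<Phi>1)
      then have "poly h 1 * poly a 1 = 0" by (simp add: a)
      \<comment> \<open>The values of \<open>h\<close> and \<open>q\<close> at 1 have product -1, so
        that of \<open>h\<close> is invertible.\<close>
      then have "poly h 1 * poly q 1 * poly a 1 = 0" by (metis mult.assoc mult.commute mult_zero_left)
      then have "poly a 1 = 0" using hq\<Phi> \<Phi>1 by (simp flip: poly_mult)
      then have "[:-1, 1:] dvd a" by (simp add: poly_eq_0_iff_dvd)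
      then show "[:-1, 1:] * h dvd Poly d" unfolding a by (metis mult.commute mult_dvd_mono dvd_refl)
    qed
    also have "\<dots> \<longleftrightarrow> b \<in> parity_extend ` cyclic_code n h"
      using parity_extend_iff[OF b, of "\<lambda>c. h dvd Poly c"]
      by (subst cyclic_code_dvd) (simp_all add: sum P_def, metis dvd_mult2 dvd_triv_right hq)
    finally show ?thesis .
  qed
  moreover have "length b = Suc n" if "b \<in> parity_extend ` cyclic_code n h" for b
    using that by (auto simp: parity_extend_def cyclic_code_def)
  moreover have "length b = Suc n" if "b \<in> dual_code (Suc n) C" for b :: "'a list" and C
    using that by (simp add: dual_code_def)
  ultimately show ?thesis by blast
qed

section \<open>The lift of a primitive polynomial\<close>

locale primitive_root =
  fixes \<alpha> :: "'f::{field,finite}" and m n :: nat and h2 :: "bit poly"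
  assumes m: "m \<ge> 2" and n: "n = 2 ^ m - 1" and card: "CARD('f) = 2 ^ m"
    and degree_h2: "degree h2 = m" and irreducible_h2: "irreducible h2"
    and root: "poly (map_poly embed_bit h2) \<alpha> = 0"
    and range: "range (\<lambda>k::nat. \<alpha> ^ k) = UNIV - {0}"
begin

lemma two: "(2::'f) = 0"
  using card by (rule char_two)

sublocale emb: ring_map "embed_bit :: bit \<Rightarrow> 'f"
  by (rule ring_map_embed_bit[OF two])

sublocale z4: ring_map "z4_map :: 4 \<Rightarrow> 'f witt2"
  by (rule ring_map_z4_map[OF two_witt2(2)[OF two]])

abbreviation ev :: "4 poly \<Rightarrow> 'f witt2" where
  "ev \<equiv> z4.eval_map (Witt2 \<alpha> 0)"

abbreviation ev2 :: "bit poly \<Rightarrow> 'f" where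
  "ev2 \<equiv> emb.eval_map \<alpha>"

lemma wfst_ev: "wfst (ev p) = ev2 (map_poly red2 p)"
proof (induction p)
  case (pCons a p)
  then show ?case by (simp add: map_poly_pCons red2_def[of 0] wfst_z4_map[OF two])
qed simp

lemma n_ge: "n \<ge> 3" "m \<le> n" "Suc n = 2 ^ m"
proof -
  have "(2::nat) ^ 2 \<le> 2 ^ m" using m by (intro power_increasing) auto
  then show "n \<ge> 3" using n by simp
  have "m < 2 ^ m" by (rule less_exp)
  then show "m \<le> n" "Suc n = 2 ^ m" unfolding n by linarith+
qed

lemma \<alpha>_nonzero: "\<alpha> \<noteq> 0"
  using range rangeI[of "\<lambda>k::nat. \<alpha> ^ k" 1] by auto

lemma \<alpha>_power: "\<alpha> ^ n = 1"
  using power_card_minus_one[OF \<alpha>_nonzero] card n by simp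

lemma card_units: "card (UNIV - {0 :: 'f}) = n"
  using card n by (simp add: card_Diff_singleton)

lemma powers: "(\<lambda>i. \<alpha> ^ i) ` {..<n} = UNIV - {0}"
proof -
  have 1: "\<alpha> ^ k = \<alpha> ^ (k mod n)" for k
  proof -
    have "\<alpha> ^ (n * (k div n) + k mod n) = \<alpha> ^ (k mod n)" by (simp only: power_add power_mult \<alpha>_power) simp
    then show ?thesis by simp
  qed
  have "range (\<lambda>k. \<alpha> ^ k) = (\<lambda>i. \<alpha> ^ i) ` {..<n}"
  proof (intro equalityI subsetI)
    fix x assume "x \<in> range (\<lambda>k. \<alpha> ^ k)"
    then obtain k where "x = \<alpha> ^ k" by blast
    then have "x = \<alpha> ^ (k mod n)" using 1 by simp
    moreover have "k mod n \<in> {..<n}" using n_ge by simp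
    ultimately show "x \<in> (\<lambda>i. \<alpha> ^ i) ` {..<n}" by (rule image_eqI)
  qed blast
  then show ?thesis using range by simp
qed

lemma inj_powers: "inj_on (\<lambda>i. \<alpha> ^ i) {..<n}"
  by (rule eq_card_imp_inj_on) (simp_all add: powers card_units)

lemma \<alpha>_neq_1: "\<alpha> \<noteq> 1"
proof
  assume "\<alpha> = 1"
  then have "\<alpha> ^ 0 = \<alpha> ^ 1" by simp
  then have "(0::nat) = 1" by (rule inj_onD[OF inj_powers]) (use n_ge in auto)
  then show False by simp
qed

text \<open>A nonzero polynomial of least degree vanishing at \<open>\<alpha>\<close> divides all
  others, \<open>h2\<close> among them, and irreducibility makes it an associate of
  \<open>h2\<close>.\<close>

lemma h2_dvd:
  assumes "ev2 s = 0"
  shows "h2 dvd s"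
proof -
  have h2: "h2 \<noteq> 0" "ev2 h2 = 0"
    using irreducible_h2 root by (auto simp: emb.eval_map_def)
  obtain d where d: "d \<noteq> 0" "ev2 d = 0" and min: "\<And>e. e \<noteq> 0 \<Longrightarrow> ev2 e = 0 \<Longrightarrow> degree d \<le> degree e"
    using ex_has_least_nat[of "\<lambda>d. d \<noteq> 0 \<and> ev2 d = 0" h2 degree] h2 by blast
  have dvd: "d dvd e" if "ev2 e = 0" for e
  proof -
    have "e = e div d * d + e mod d" by simp
    then have "ev2 e = ev2 (e div d) * ev2 d + ev2 (e mod d)"
      by (metis emb.eval_map_simps(4,7))
    then have "ev2 (e mod d) = 0" using that d by simp
    then have "e mod d = 0" using min[of "e mod d"] degree_mod_less[of d e] d(1) by force
    then show ?thesis by (rule mod_0_imp_dvd)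
  qed
  obtain e where e: "h2 = d * e" using dvd[OF h2(2)] by (elim dvdE)
  have "\<not> d dvd 1"
  proof
    assume "d dvd 1"
    then obtain k where "1 = d * k" by (elim dvdE)
    then have "ev2 1 = ev2 d * ev2 k" by (metis emb.eval_map_simps(7))
    then show False using d by simp
  qed
  then have "e dvd 1" using irreducibleD[OF irreducible_h2 e] by blast
  then have "h2 dvd d" unfolding e by (simp add: mult_unit_dvd_iff)
  then show ?thesis using dvd[OF assms] by (rule dvd_trans)
qed

lemma red2_eq_0_iff: "red2 a = 0 \<longleftrightarrow> a = 0 \<or> a = 2"
  by (simp add: red2_def)

lemma coeff_map_red2: "coeff (map_poly red2 p) i = red2 (coeff p i)"
  by (rule coeff_map_poly) (simp add: red2_def)

lemma map_red2_eq_0: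
  assumes "\<And>i. i \<ge> m \<Longrightarrow> coeff p i = 0" "wfst (ev p) = 0"
  shows "map_poly red2 p = 0"
proof (rule ccontr)
  assume nz: "map_poly red2 p \<noteq> 0"
  have "h2 dvd map_poly red2 p" using assms(2) by (intro h2_dvd) (simp add: wfst_ev)
  then have "m \<le> degree (map_poly red2 p)" using nz degree_h2 dvd_imp_degree_le by blast
  then have "red2 (coeff p (degree (map_poly red2 p))) = 0" using assms(1) by (simp add: red2_def)
  then show False using nz by (metis coeff_map_red2 leading_coeff_0_iff)
qed

text \<open>Injectivity by two rounds of reduction modulo 2: the residue of \<open>p\<close>
  vanishes, so \<open>p\<close> is twice some \<open>s\<close>; the residue of \<open>s\<close>
  vanishes too, so \<open>p\<close> is divisible by 4.\<close>

lemma ev_eq_0: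
  assumes deg: "\<And>i. i \<ge> m \<Longrightarrow> coeff p i = 0" and ev: "ev p = 0"
  shows "p = 0"
proof -
  have "map_poly red2 p = 0" using map_red2_eq_0[OF deg] ev by simp
  then have p: "coeff p i = 0 \<or> coeff p i = 2" for i
    by (metis coeff_map_red2 coeff_0 red2_eq_0_iff)
  \<comment> \<open>Half of \<open>p\<close>, whose coefficients are now all 0 or 2.\<close>
  define s where "s = map_poly (\<lambda>a::4. if a = 2 then 1 else 0 :: 4) p"
  have s: "coeff s i = (if coeff p i = 2 then 1 else 0)" for i
    unfolding s_def by (subst coeff_map_poly) auto
  have p_eq: "p = smult 2 s"
    by (rule poly_eqI) (use p in \<open>auto simp: s\<close>)
  then have "2 * ev s = 0" using ev by (simp add: z4_map_def)
  then have "wfst (ev s) ^ 2 = 0" unfolding two_times_witt2[OF two] by (simp add: zero_witt2_def)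
  then have "wfst (ev s) = 0" by simp
  then have "map_poly red2 s = 0" by (intro map_red2_eq_0) (auto simp: s deg)
  then have s2: "coeff s i = 0 \<or> coeff s i = 2" for i
    by (metis coeff_map_red2 coeff_0 red2_eq_0_iff)
  have "2 * coeff s i = 0" for i using s2[of i] by auto
  then show ?thesis unfolding p_eq by (intro poly_eqI) simp
qed

abbreviation lift_poly :: "4 poly \<Rightarrow> bool" where
  "lift_poly h \<equiv> coeff h m = 1 \<and> degree h = m \<and> ev h = 0"

text \<open>By counting: \<open>ev\<close> is injective on polynomials of degree less than
  \<open>m\<close>, and both sides have 4 ^ m elements.\<close>

lemma surj_ev:
  obtains r where "\<And>i. i \<ge> m \<Longrightarrow> coeff r i = 0" "ev r = y"
proof -
  let ?S = "{p :: 4 poly. \<forall>i\<ge>m. coeff p i = 0}"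
  have inj: "inj_on ev ?S"
  proof (rule inj_onI)
    fix p q assume "p \<in> ?S" "q \<in> ?S" "ev p = ev q"
    then have "p - q = 0" by (intro ev_eq_0) auto
    then show "p = q" by simp
  qed
  have "card (ev ` ?S) = 4 ^ m" using card_image[OF inj] card_bounded_polys[of m, where 'a = 4] by simp
  also have "\<dots> = CARD('f witt2)" by (simp add: card_witt2 card power2_eq_square flip: power_mult_distrib)
  finally have "ev ` ?S = UNIV" by (intro card_subset_eq) auto
  then have "y \<in> ev ` ?S" by blast
  then show ?thesis using that by auto
qed

text \<open>The remainder of \<open>p\<close> has degree less than \<open>m\<close> and is settled
  by \<open>ev_eq_0\<close>. Membership in the code of \<open>h\<close> thereby becomes a single
  equation over the Witt vectors.\<close>

lemma lift_dvd_iff: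
  assumes "lift_poly h"
  shows "h dvd p \<longleftrightarrow> ev p = 0"
proof
  assume "h dvd p"
  then show "ev p = 0" using assms by (auto elim!: dvdE)
next
  assume ev: "ev p = 0"
  obtain q r where qr: "p = h * q + r" "r = 0 \<or> degree r < degree h"
    using monic_division[of h p] assms by auto
  have "r = 0"
  proof (rule ev_eq_0)
    show "coeff r i = 0" if "i \<ge> m" for i using qr(2) assms that by (auto simp: coeff_eq_0)
    show "ev r = 0" using ev assms unfolding qr(1) by simp
  qed
  then show "h dvd p" using qr by simp
qed

lemma ev_monom_minus_1: "ev (monom 1 n - 1) = 0"
  by (simp add: teichmueller_power \<alpha>_power flip: one_witt2_def)

lemma monic_dvd_eq:
  assumes "h2 dvd s" "degree s = m" "s \<noteq> 0"
  shows "s = h2"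
proof -
  obtain t where t: "s = h2 * t" using assms(1) by (elim dvdE)
  then have "h2 \<noteq> 0" "t \<noteq> 0" using assms(3) by auto
  then have "degree t = 0" using assms(2) t degree_h2 by (simp add: degree_mult_eq)
  then obtain c where c: "t = [:c:]" by (metis degree_eq_zeroE)
  then have "c = 1" using \<open>t \<noteq> 0\<close> by (metis bit_not_zero_iff pCons_0_0)
  then show ?thesis using t c by simp
qed

lemma Z4_lift_if_lift_poly:
  assumes h: "lift_poly h"
  shows "is_Z4_lift n h2 h"
proof -
  let ?s = "map_poly red2 h"
  have "coeff ?s m = 1" using h by (simp add: coeff_map_red2 red2_def)
  moreover have "degree ?s \<le> m"
    by (rule degree_le) (use h in \<open>auto simp: coeff_map_red2 coeff_eq_0 red2_def\<close>)
  ultimately have "degree ?s = m" "?s \<noteq> 0"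
    by (metis le_antisym le_degree zero_neq_one, metis coeff_0 zero_neq_one)
  moreover have "h2 dvd ?s"
    by (rule h2_dvd) (use h in \<open>simp flip: wfst_ev\<close>)
  ultimately have "?s = h2" by (intro monic_dvd_eq)
  moreover have "h dvd monom 1 n - 1" using lift_dvd_iff[OF h] ev_monom_minus_1 by blast
  ultimately show ?thesis using h degree_h2 by (simp add: is_Z4_lift_def)
qed

text \<open>As in Hensel's lemma: \<open>\<alpha>\<close> is a simple root of X ^ n - 1, so the
  cofactor \<open>k\<close> has a nonzero residue there. Then \<open>ev k\<close> is a unit, and
  \<open>ev h * ev k = 0\<close> forces \<open>ev h = 0\<close>.\<close>

lemma lift_poly_if_Z4_lift:
  assumes "is_Z4_lift n h2 h"
  shows "lift_poly h"
proof -
  have h: "lead_coeff h = 1" "degree h = m" "map_poly red2 h = h2" "h dvd monom 1 n - 1"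
    using assms degree_h2 by (auto simp: is_Z4_lift_def)
  obtain k where k: "monom 1 n - 1 = h * k" using h(4) by (elim dvdE)
  define H K :: "'f poly" where "H = map_poly embed_bit (map_poly red2 h)" and "K = map_poly embed_bit (map_poly red2 k)"
  interpret red: ring_map red2 by (rule ring_map_red2)
  have H0: "poly H \<alpha> = 0" using root by (simp add: H_def h)
  have "H * K = map_poly embed_bit (map_poly red2 (h * k))"
    by (simp add: H_def K_def red.map_poly_mult emb.map_poly_mult)
  also have "\<dots> = monom 1 n - 1"
    unfolding k[symmetric] by (simp add: red.map_poly_diff emb.map_poly_diff map_poly_monom)
  \<comment> \<open>The derivative n * X ^ (n - 1) is nonzero at \<open>\<alpha>\<close>, so
    \<open>\<alpha>\<close> cannot be a root of both factors.\<close>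
  finally have "pderiv (H * K) = monom (of_nat n) (n - 1)" by (simp add: pderiv_diff pderiv_monom)
  then have "poly H \<alpha> * poly (pderiv K) \<alpha> + poly (pderiv H) \<alpha> * poly K \<alpha> = of_nat n * \<alpha> ^ (n - 1)"
    by (metis (no_types, lifting) pderiv_mult poly_add poly_monom poly_mult mult.commute)
  moreover have "of_nat n = (1::'f)"
  proof -
    have "of_nat (Suc n) = (0::'f)" unfolding n_ge(3) using two m by simp
    then show ?thesis using add_eq_0_char_two[OF two, of 1 "of_nat n"] by simp
  qed
  ultimately have K: "poly K \<alpha> \<noteq> 0" using H0 \<alpha>_nonzero by auto
  have eq: "ev h * ev k = 0" using ev_monom_minus_1 unfolding k by simp
  moreover have wh: "wfst (ev h) = 0" and wk: "wfst (ev k) \<noteq> 0"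
    using H0 K by (simp_all add: wfst_ev emb.eval_map_def H_def K_def)
  ultimately have "wfst (ev k) ^ 2 * wsnd (ev h) = 0"
    using two by (simp add: times_witt2_def zero_witt2_def)
  then have "wsnd (ev h) = 0" using wk by simp
  then have "ev h = 0" using wh by (simp add: zero_witt2_def witt2.expand)
  then show ?thesis using h by simp
qed

lemma Z4_lift_iff: "is_Z4_lift n h2 h \<longleftrightarrow> lift_poly h"
  using Z4_lift_if_lift_poly lift_poly_if_Z4_lift by blast

lemma ex1_Z4_lift: "\<exists>!h. is_Z4_lift n h2 h"
proof (rule ex_ex1I)
  \<comment> \<open>This is the relation expressing X ^ m by lower powers at the Teichmueller
    representative.\<close>
  obtain r where r: "\<And>i. i \<ge> m \<Longrightarrow> coeff r i = 0" "ev r = - ev (monom 1 m)" using surj_ev by metis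
  define h where "h = monom 1 m + r"
  have "coeff h m = 1" using r by (simp add: h_def)
  moreover have "degree h \<le> m" by (rule degree_le) (use r in \<open>auto simp: h_def\<close>)
  ultimately have "degree h = m" by (metis le_antisym le_degree zero_neq_one)
  then have "lift_poly h" using \<open>coeff h m = 1\<close> r by (simp add: h_def)
  then show "\<exists>h. is_Z4_lift n h2 h" using Z4_lift_iff by blast
next
  fix h h' assume "is_Z4_lift n h2 h" "is_Z4_lift n h2 h'"
  then have h: "lift_poly h" "lift_poly h'" by (simp_all add: Z4_lift_iff)
  have "h - h' = 0"
  proof (rule ev_eq_0)
    show "coeff (h - h') i = 0" if "i \<ge> m" for i
      using that h by (cases "i = m") (auto simp: coeff_eq_0)
  qed (use h in simp)
  then show "h = h'" by simp
qed

text \<open>As \<open>m \<ge> 2\<close>, 4 divides \<open>n + 1\<close>; this supplies a hypothesis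
  of \<open>dual_extended_cyclic_code\<close>.\<close>

lemma of_nat_n: "of_nat n = (-1 :: 4)"
proof -
  have "of_nat (Suc n) = (of_nat (4 * 2 ^ (m - 2)) :: 4)"
    unfolding n_ge(3) using m by (metis le_add_diff_inverse power_add numeral_times_numeral power2_eq_square mult_2 numeral_Bit0)
  also have "\<dots> = of_nat 4 * of_nat (2 ^ (m - 2))" by (rule of_nat_mult)
  also have "(of_nat 4 :: 4) = 0" by simp
  finally show ?thesis by (simp add: eq_neg_iff_add_eq_0 add.commute)
qed

text \<open>X - 1 has a nonzero residue at \<open>\<alpha>\<close>, so the root of X ^ n - 1 passes
  to the cofactor \<open>\<Phi>\<close>, which \<open>h\<close> then divides. Both divisors are
  monic, which makes the quotient unique and hence the value of \<open>poly_quot\<close>.\<close>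

lemma ex_cofactor:
  assumes h: "lift_poly h"
  obtains q where "[:-1, 1:] * h * q = monom 1 n - 1"
    "poly_quot (monom 1 n - 1) ([:-1, 1:] * h) = q"
proof -
  define \<Phi> :: "4 poly" where "\<Phi> = (\<Sum>i<n. monom 1 i)"
  have X: "[:-1, 1:] * \<Phi> = monom 1 n - 1" unfolding \<Phi>_def by (rule geometric_sum_poly)
  have "ev [:-1, 1:] * ev \<Phi> = 0" using ev_monom_minus_1 unfolding X[symmetric] by (simp only: z4.eval_map_simps)
  moreover have "wfst (ev [:-1, 1:]) \<noteq> 0"
    using \<alpha>_neq_1 add_eq_0_char_two[OF two, of 1 \<alpha>] by (simp add: wfst_z4_map[OF two] red2_def embed_bit_def)
  ultimately have "ev \<Phi> = 0"
    by (auto simp: times_witt2_def zero_witt2_def two intro: witt2.expand)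
  then obtain q where q: "\<Phi> = h * q" using lift_dvd_iff[OF h] by (auto elim: dvdE)
  have eq: "monom 1 n - 1 = [:-1, 1:] * h * q" unfolding X[symmetric] q by (simp only: mult.assoc)
  moreover have "poly_quot (monom 1 n - 1) ([:-1, 1:] * h) = q"
    unfolding poly_quot_def
  proof (rule the_equality)
    show "monom 1 n - 1 = [:-1, 1:] * h * q" by (rule eq)
    fix q' assume "monom 1 n - 1 = [:-1, 1:] * h * q'"
    then have "[:-1, 1:] * h * q' = [:-1, 1:] * h * q" using eq by (rule trans[OF sym])
    then have "[:-1, 1:] * (h * (q' - q)) = 0"
      by (simp only: right_diff_distrib mult.assoc[symmetric] diff_self)
    then have "h * (q' - q) = 0" by (rule monic_mult_eq_0[rotated]) simp
    then have "q' - q = 0" by (rule monic_mult_eq_0[rotated]) (use h in simp)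
    then show "q' = q" by simp
  qed
  ultimately show ?thesis using that by metis
qed

text \<open>Codewords correspond to the multiples \<open>h * a\<close> with \<open>a\<close> of
  degree less than \<open>n - m\<close>: since \<open>h\<close> is monic, no degree drops in these
  products.\<close>

lemma card_cyclic_code:
  assumes h: "lift_poly h"
  shows "card (cyclic_code n h) = 4 ^ (n - m)"
proof -
  let ?S = "{p :: 4 poly. \<forall>i\<ge>n - m. coeff p i = 0}"
  have code: "cyclic_code n h = {c. length c = n \<and> h dvd Poly c}"
    using lift_dvd_iff[OF h] ev_monom_minus_1 by (intro cyclic_code_dvd) simp
  have deg: "coeff (h * a) (m + degree a) = lead_coeff a" for a
    using coeff_mult_degree_sum[of h a] h by simp
  have Poly: "Poly (map (coeff (h * a)) [0..<n]) = h * a" if "a \<in> ?S" for a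
  proof (rule poly_eqI)
    fix i
    have "coeff (h * a) i = 0" if "i \<ge> n"
    proof (cases "a = 0")
      case False
      then have "degree a < n - m" using \<open>a \<in> ?S\<close> leading_coeff_0_iff[of a] not_less by blast
      then have "degree (h * a) < n" using degree_mult_le[of h a] h n_ge by simp
      then show ?thesis using that by (simp add: coeff_eq_0)
    qed simp
    then show "coeff (Poly (map (coeff (h * a)) [0..<n])) i = coeff (h * a) i"
      by (simp add: nth_default_def)
  qed
  have "bij_betw (\<lambda>a. map (coeff (h * a)) [0..<n]) ?S (cyclic_code n h)"
  proof (intro bij_betw_imageI inj_onI equalityI subsetI)
    fix a b assume ab: "a \<in> ?S" "b \<in> ?S" "map (coeff (h * a)) [0..<n] = map (coeff (h * b)) [0..<n]"
    then have "Poly (map (coeff (h * a)) [0..<n]) = Poly (map (coeff (h * b)) [0..<n])" by (intro arg_cong[where f = Poly])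
    then have "h * a = h * b" unfolding Poly[OF ab(1)] Poly[OF ab(2)] .
    then have "h * (a - b) = 0" by (simp add: right_diff_distrib)
    then have "a - b = 0" by (rule monic_mult_eq_0[rotated]) (use h in simp)
    then show "a = b" by simp
  next
    fix c assume "c \<in> (\<lambda>a. map (coeff (h * a)) [0..<n]) ` ?S"
    then obtain a where "a \<in> ?S" "c = map (coeff (h * a)) [0..<n]" by blast
    then show "c \<in> cyclic_code n h" unfolding code using Poly[of a] by simp
  next
    fix c assume "c \<in> cyclic_code n h"
    then obtain a where a: "length c = n" "Poly c = h * a" unfolding code by (auto elim: dvdE)
    have c: "c ! i = coeff (h * a) i" if "i < n" for i
      unfolding a(2)[symmetric] using that a(1) by (simp add: nth_default_def)
    have "a \<in> ?S"
    proof (cases "a = 0")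
      case False
      have "m + degree a < n"
      proof (rule ccontr)
        assume "\<not> m + degree a < n"
        then have "coeff (Poly c) (m + degree a) = 0" using a(1) by (simp add: nth_default_def)
        then show False using deg[of a] False unfolding a(2) by simp
      qed
      then show ?thesis by (auto intro: coeff_eq_0)
    qed simp
    moreover have "c = map (coeff (h * a)) [0..<n]" using c a(1) by (intro nth_equalityI) auto
    ultimately show "c \<in> (\<lambda>a. map (coeff (h * a)) [0..<n]) ` ?S" by blast
  qed
  then show ?thesis using card_bounded_polys[of "n - m", where 'a = 4] by (simp add: bij_betw_same_card[symmetric])
qed

end

section \<open>The Gray map and the Lee weight\<close>

definition lee_weight :: "4 \<Rightarrow> nat" where
  "lee_weight a = (if a = 0 then 0 else if a = 2 then 2 else 1)"

text \<open>The Gray map is an isometry from Lee to Hamming distance. Distances thus depend only on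
  differences over the integers modulo 4, although the binary image need not be linear.\<close>

lemma gray_lee: "of_bool (gray_beta a \<noteq> gray_beta b) + of_bool (gray_gamma a \<noteq> gray_gamma b) = lee_weight (a - b)"
  using four_cases[of a] four_cases[of b]
  by (elim disjE) (simp_all add: gray_beta_def gray_gamma_def lee_weight_def)

lemma length_gray_map: "length (gray_map c) = 2 * length c"
  by (simp add: gray_map_def)

lemma inj_on_gray_map: "inj_on gray_map {c. length c = N}"
proof (rule inj_onI)
  fix c d assume len: "c \<in> {c. length c = N}" "d \<in> {c. length c = N}" and "gray_map c = gray_map d"
  then have eq: "map gray_beta c = map gray_beta d" "map gray_gamma c = map gray_gamma d"
    by (simp_all add: gray_map_def)
  have "c ! i = d ! i" if "i < N" for i
  proof -
    have "gray_beta (c ! i) = gray_beta (d ! i)" "gray_gamma (c ! i) = gray_gamma (d ! i)"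
      using eq len that by (metis (mono_tags) mem_Collect_eq nth_map)+
    then have "lee_weight (c ! i - d ! i) = 0" by (simp flip: gray_lee)
    then show ?thesis by (simp add: lee_weight_def split: if_splits)
  qed
  then show "c = d" using len by (intro nth_equalityI) auto
qed

lemma hamming_dist_gray_map:
  assumes "distinct xs" "set xs = (UNIV :: 'f::finite set)"
  shows "hamming_dist (gray_map (map v xs)) (gray_map (map w xs)) = (\<Sum>x\<in>(UNIV :: 'f set). lee_weight (v x - w x))"
proof -
  have card: "card {x :: 'f. P x} = (\<Sum>x\<in>UNIV. of_bool (P x))" for P by simp
  have "hamming_dist (gray_map (map v xs)) (gray_map (map w xs)) =
      card {x. gray_beta (v x) \<noteq> gray_beta (w x)} + card {x. gray_gamma (v x) \<noteq> gray_gamma (w x)}"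
    using hamming_dist_map[OF assms(1), of "\<lambda>x. gray_beta (v x)" "\<lambda>x. gray_beta (w x)"]
      hamming_dist_map[OF assms(1), of "\<lambda>x. gray_gamma (v x)" "\<lambda>x. gray_gamma (w x)"] assms(2)
    by (simp add: gray_map_def hamming_dist_append comp_def)
  then show ?thesis by (simp only: card gray_lee flip: sum.distrib)
qed

lemma of_nat_4_eq_0_iff: "(of_nat k :: 4) = 0 \<longleftrightarrow> 4 dvd k"
proof -
  have "(of_nat k :: 4) = of_nat (4 * (k div 4) + k mod 4)" by simp
  also have "\<dots> = of_nat 4 * of_nat (k div 4) + of_nat (k mod 4)" by (simp only: of_nat_add of_nat_mult)
  also have "(of_nat 4 :: 4) = 0" by simp
  finally have "(of_nat k :: 4) = of_nat (k mod 4)" by simp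
  moreover have "k mod 4 = 0 \<or> k mod 4 = 1 \<or> k mod 4 = 2 \<or> k mod 4 = 3" by presburger
  ultimately show ?thesis by (auto simp: dvd_eq_mod_eq_0)
qed

section \<open>Counting entries by value\<close>

lemma sum_four:
  fixes e :: "'b::finite \<Rightarrow> 4" and f :: "'b \<Rightarrow> 'a::comm_ring_1"
  shows "(\<Sum>x\<in>UNIV. z4_map (e x) * f x) =
    sum f {x. e x = 1} + 2 * sum f {x. e x = 2} + 3 * sum f {x. e x = 3}"
proof -
  have "z4_map (e x) * f x = (if e x = 1 then f x else 0) + 2 * (if e x = 2 then f x else 0) + 3 * (if e x = 3 then f x else 0)" for x
    using four_cases[of "e x"] by (auto simp: z4_map_def)
  then have "(\<Sum>x\<in>UNIV. z4_map (e x) * f x) =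
      (\<Sum>x\<in>UNIV. if e x = 1 then f x else 0) + 2 * (\<Sum>x\<in>UNIV. if e x = 2 then f x else 0)
        + 3 * (\<Sum>x\<in>UNIV. if e x = 3 then f x else 0)"
    by (simp only: sum.distrib sum_distrib_left)
  then show ?thesis by (simp add: sum.If_cases)
qed

lemma sum_lee_weight:
  fixes e :: "'b::finite \<Rightarrow> 4"
  shows "(\<Sum>x\<in>UNIV. lee_weight (e x)) = card {x. e x = 1} + 2 * card {x. e x = 2} + card {x. e x = 3}"
proof -
  have "lee_weight (e x) = (if e x = 1 then 1 else 0) + 2 * (if e x = 2 then 1 else 0) + (if e x = 3 then 1 else 0)" for x
    using four_cases[of "e x"] by (auto simp: lee_weight_def)
  then have "(\<Sum>x\<in>UNIV. lee_weight (e x)) =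
      (\<Sum>x\<in>UNIV. if e x = 1 then 1 else 0) + 2 * (\<Sum>x\<in>UNIV. if e x = 2 then 1 else 0)
        + (\<Sum>x\<in>UNIV. if e x = 3 then 1 else 0)"
    by (simp only: sum.distrib sum_distrib_left)
  then show ?thesis by (simp add: sum.If_cases)
qed

lemma z4_map_id: "z4_map a = (a :: 4)"
  using four_cases[of a] by (auto simp: z4_map_def)

lemma sum_eq_0_iff_4:
  fixes e :: "'b::finite \<Rightarrow> 4"
  shows "(\<Sum>x\<in>UNIV. e x) = 0 \<longleftrightarrow> 4 dvd card {x. e x = 1} + 2 * card {x. e x = 2} + 3 * card {x. e x = 3}"
proof -
  have "(\<Sum>x\<in>UNIV. e x) = of_nat (card {x. e x = 1} + 2 * card {x. e x = 2} + 3 * card {x. e x = 3})"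
    using sum_four[of e "\<lambda>_. 1 :: 4"] by (simp add: z4_map_id)
  then show ?thesis by (simp only: of_nat_4_eq_0_iff)
qed

text \<open>A word of the extended code as a function on the field: the coordinate at \<^term>\<open>\<alpha> ^ i\<close>
  is the coefficient of \<^term>\<open>X ^ i\<close>, and the coordinate at 0 is the parity check.\<close>

definition preparata_words :: "('f::field \<Rightarrow> 4) set" where
  "preparata_words = {w. (\<Sum>x\<in>UNIV. w x) = 0 \<and> (\<Sum>x\<in>UNIV. z4_map (w x) * Witt2 x 0) = 0}"

lemma zero_preparata_words: "(\<lambda>_. 0) \<in> preparata_words"
  by (simp add: preparata_words_def z4_map_def)

context
  fixes m :: nat
  assumes card: "CARD('f::{field,finite}) = 2 ^ m"
begin

lemma two_f: "(2::'f) = 0"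
  using card by (rule char_two)

lemma preparata_words_diff:
  assumes "v \<in> preparata_words" "w \<in> preparata_words"
  shows "(\<lambda>x::'f. v x - w x) \<in> preparata_words"
proof -
  interpret z4: ring_map "z4_map :: 4 \<Rightarrow> 'f witt2"
    by (rule ring_map_z4_map[OF two_witt2(2)[OF two_f]])
  have "z4_map (v x - w x) * Witt2 x 0 = z4_map (v x) * Witt2 x 0 - z4_map (w x) * Witt2 x 0" for x
    using z4.map_add[of "v x" "- w x"] by (simp add: z4.map_uminus left_diff_distrib)
  then show ?thesis using assms by (simp add: preparata_words_def sum_subtractf)
qed

lemma even_lee_weight:
  assumes "w \<in> (preparata_words :: ('f \<Rightarrow> 4) set)"
  shows "even (\<Sum>x\<in>UNIV. lee_weight (w x))"
proof -
  have "(\<Sum>x\<in>UNIV. w x) = 0" using assms by (simp add: preparata_words_def)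
  then have "4 dvd card {x. w x = 1} + 2 * card {x. w x = 2} + 3 * card {x. w x = 3}"
    by (simp only: sum_eq_0_iff_4)
  \<comment> \<open>The Lee weight a + 2 * b + c and the sum a + 2 * b + 3 * c have the same
    parity.\<close>
  then show ?thesis unfolding sum_lee_weight by presburger
qed

text \<open>The components are the elementary symmetric functions of \<open>a\<close> and
  \<open>b\<close>, so equations between sums of representatives constrain these functions.\<close>

lemma teichmueller_add: "Witt2 a 0 + Witt2 b 0 = Witt2 (a + b) (a * b :: 'f)"
  by (simp add: plus_witt2_def char_two_simps[OF two_f])

text \<open>The sum and the second elementary symmetric function of the four elements vanish; with
  \<open>d = a + b + c\<close> the latter is the norm form at \<open>a + c\<close> and
  \<open>b + c\<close>.\<close>

lemma teichmueller_four:
  assumes "odd m" "Witt2 a 0 + Witt2 b 0 + (Witt2 c 0 + Witt2 d 0) = (0 :: 'f witt2)"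
  shows "a = b"
proof -
  have "Witt2 (a + b + (c + d)) (a * b + c * d + (a + b) * (c + d)) = (0 :: 'f witt2)"
    using assms(2) unfolding teichmueller_add by (simp add: plus_witt2_def char_two_simps[OF two_f])
  then have 1: "a + b + (c + d) = 0" and 2: "a * b + c * d + (a + b) * (c + d) = 0"
    by (simp_all add: zero_witt2_def)
  have d: "d = a + b + c"
    using 1 add_eq_0_char_two[OF two_f, of "a + b + c" d] by (simp add: add.assoc)
  have "(a + c) ^ 2 + (a + c) * (b + c) + (b + c) ^ 2 = a * b + c * d + (a + b) * (c + d)"
    unfolding d by (simp add: power2_eq_square algebra_simps char_two_simps[OF two_f])
  also have "\<dots> = 0" by (rule 2)
  finally have "a + c = 0 \<and> b + c = 0" by (rule norm_form_eq_0[OF card assms(1)])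
  then show "a = b" by (metis add_right_imp_eq)
qed

text \<open>Equal sums and products make both pairs the roots of the same quadratic
  polynomial.\<close>

lemma teichmueller_pairs:
  assumes "Witt2 a 0 + Witt2 b 0 = Witt2 c 0 + Witt2 (d :: 'f) 0"
  shows "a = c \<or> a = d"
proof -
  have 1: "a + b = c + d" and 2: "a * b = c * d" using assms by (simp_all add: teichmueller_add)
  have "(a - c) * (a - d) = a * a - a * (c + d) + c * d" by (simp add: algebra_simps)
  also have "\<dots> = 0" unfolding 1[symmetric] 2[symmetric] by (simp add: algebra_simps)
  finally show ?thesis by simp
qed

text \<open>\<open>a\<close>, \<open>b\<close>, \<open>c\<close> stand for the numbers of entries 1,
  2, 3; the first hypothesis is a zero coordinate sum, the second a Lee weight below 6.\<close>

lemma lee_small_cases: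
  fixes a b c :: nat
  assumes "4 dvd a + 2 * b + 3 * c" "a + 2 * b + c < 6"
  shows "a = 0 \<and> b = 0 \<and> c = 0 \<or> a = 1 \<and> b = 0 \<and> c = 1 \<or> a = 0 \<and> b = 2 \<and> c = 0 \<or>
    a = 2 \<and> b = 1 \<and> c = 0 \<or> a = 0 \<and> b = 1 \<and> c = 2 \<or> a = 4 \<and> b = 0 \<and> c = 0 \<or>
    a = 2 \<and> b = 0 \<and> c = 2 \<or> a = 0 \<and> b = 0 \<and> c = 4"
proof -
  have "even (a + c)" using assms(1) by presburger
  then have "a + c = 0 \<or> a + c = 2 \<or> a + c = 4" using assms(2) by presburger
  moreover have dvd: "4 dvd (a + c) + 2 * b + 2 * c" using assms(1) by (simp add: algebra_simps)
  ultimately show ?thesis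
  proof (elim disjE)
    assume s: "a + c = 0"
    then have "b = 0 \<or> b = 1 \<or> b = 2" using assms(2) by linarith
    then show ?thesis using s dvd by auto
  next
    assume s: "a + c = 2"
    then have bc: "b = 0 \<or> b = 1" "c = 0 \<or> c = 1 \<or> c = 2" using assms(2) by linarith+
    have a: "a = 2 - c" using s by simp
    show ?thesis using bc dvd unfolding s a by (elim disjE) (simp_all del: One_nat_def)
  next
    assume s: "a + c = 4"
    then have bc: "b = 0" "c = 0 \<or> c = 1 \<or> c = 2 \<or> c = 3 \<or> c = 4" using assms(2) by linarith+
    have a: "a = 4 - c" using s by simp
    show ?thesis using bc dvd unfolding s a by (elim disjE) (simp_all del: One_nat_def)
  qed
qed

text \<open>Reading 3 as -1 moves the points of \<open>C\<close> to the other side: the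
  representatives over \<open>A\<close> plus twice those over \<open>B\<close> equal those over
  \<open>C\<close>. Each nonzero pattern of \<open>lee_small_cases\<close> is refuted by comparing
  residues, by dividing by 2, or by the lemmas on four representatives and on pairs.\<close>

lemma preparata_words_small:
  assumes "odd m" and e: "e \<in> (preparata_words :: ('f \<Rightarrow> 4) set)"
    and small: "(\<Sum>x\<in>UNIV. lee_weight (e x)) < 6"
  shows "e = (\<lambda>_. 0)"
proof -
  define A B C where "A = {x. e x = 1}" and "B = {x. e x = 2}" and "C = {x. e x = 3}"
  let ?t = "\<lambda>x::'f. Witt2 x 0"
  have disj: "A \<inter> C = {}" by (auto simp: A_def C_def)
  have "4 dvd card A + 2 * card B + 3 * card C"
    using e by (simp add: preparata_words_def sum_eq_0_iff_4 A_def B_def C_def)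
  moreover have "card A + 2 * card B + card C < 6"
    using small by (simp add: sum_lee_weight A_def B_def C_def)
  moreover have "sum ?t A + 2 * sum ?t B + 3 * sum ?t C = 0"
    using e sum_four[of e ?t] by (simp add: preparata_words_def A_def B_def C_def)
  \<comment> \<open>Adding the sum over \<open>C\<close> once more makes its coefficient 4 =
    0.\<close>
  then have "sum ?t A + 2 * sum ?t B + 3 * sum ?t C + sum ?t C = sum ?t C" by simp
  then have t: "sum ?t A + 2 * sum ?t B = sum ?t C"
  proof -
    have "sum ?t A + 2 * sum ?t B + 3 * sum ?t C + sum ?t C = sum ?t A + 2 * sum ?t B + 4 * sum ?t C"
      by (simp add: algebra_simps)
    then show ?thesis
      using \<open>sum ?t A + 2 * sum ?t B + 3 * sum ?t C + sum ?t C = sum ?t C\<close>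
      by (simp add: two_witt2(2)[OF two_f])
  qed
  have w: "wfst (sum ?t X) = (\<Sum>x\<in>X. x)" for X :: "'f set"
    by (induction X rule: infinite_finite_induct) auto
  have w2: "wfst (2 :: 'f witt2) = 0" by (simp add: two_witt2(1)[OF two_f])
  have t1: "(\<Sum>x\<in>A. x) = (\<Sum>x\<in>C. x)" using arg_cong[OF t, of wfst] by (simp only: wfst_simps w w2) simp
  have two_points: "x = y" if "x + y = 0" for x y :: 'f
    using that add_eq_0_char_two[OF two_f] by blast
  have "card A = 0 \<and> card B = 0 \<and> card C = 0"
    using lee_small_cases[OF calculation]
  proof (elim disjE)
    assume *: "card A = 1 \<and> card B = 0 \<and> card C = 1"
    then obtain x y where "A = {x}" "C = {y}" by (auto simp: card_1_singleton_iff)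
    then show ?thesis using t1 disj by simp
  next
    assume *: "card A = 0 \<and> card B = 2 \<and> card C = 0"
    then obtain x y where xy: "B = {x, y}" "x \<noteq> y" "A = {}" "C = {}" by (auto simp: card_2_iff)
    then have "2 * (?t x + ?t y) = 0" using t by simp
    then have "wfst (?t x + ?t y) ^ 2 = 0" unfolding two_times_witt2[OF two_f] zero_witt2_def by simp
    then have "x + y = 0" by simp
    then show ?thesis using two_points xy by blast
  next
    assume *: "card A = 2 \<and> card B = 1 \<and> card C = 0"
    then obtain x y where xy: "A = {x, y}" "x \<noteq> y" "C = {}" by (auto simp: card_2_iff)
    then have "x + y = 0" using t1 by simp
    then show ?thesis using two_points xy by blast
  next
    assume *: "card A = 0 \<and> card B = 1 \<and> card C = 2"
    then obtain x y where xy: "C = {x, y}" "x \<noteq> y" "A = {}" by (auto simp: card_2_iff)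
    then have "x + y = 0" using t1 by simp
    then show ?thesis using two_points xy by blast
  next
    assume *: "card A = 4 \<and> card B = 0 \<and> card C = 0"
    then obtain x y z u where "A = {x, y, z, u}" "x \<noteq> y" "x \<noteq> z" "x \<noteq> u" "y \<noteq> z" "y \<noteq> u" "z \<noteq> u"
      by (metis card_4E)
    moreover have "B = {}" "C = {}" using * by auto
    ultimately have "?t x + ?t y + (?t z + ?t u) = 0" "x \<noteq> y" using t by (simp_all add: add.assoc)
    then show ?thesis using teichmueller_four[OF assms(1)] by blast
  next
    assume *: "card A = 2 \<and> card B = 0 \<and> card C = 2"
    then obtain x y z u where xy: "A = {x, y}" "x \<noteq> y" "C = {z, u}" "z \<noteq> u" "B = {}" by (auto simp: card_2_iff)
    then have "?t x + ?t y = ?t z + ?t u" using t by simp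
    then show ?thesis using teichmueller_pairs disj xy by blast
  next
    assume *: "card A = 0 \<and> card B = 0 \<and> card C = 4"
    then obtain x y z u where "C = {x, y, z, u}" "x \<noteq> y" "x \<noteq> z" "x \<noteq> u" "y \<noteq> z" "y \<noteq> u" "z \<noteq> u"
      by (metis card_4E)
    moreover have "A = {}" "B = {}" using * by auto
    ultimately have "?t x + ?t y + (?t z + ?t u) = 0" "x \<noteq> y" using t by (simp_all add: add.assoc)
    then show ?thesis using teichmueller_four[OF assms(1)] by blast
  qed simp
  then have "A = {}" "B = {}" "C = {}" by auto
  then have "e x = 0" for x using four_cases[of "e x"] by (auto simp: A_def B_def C_def)
  then show ?thesis by auto
qed

text \<open>For distinct \<^term>\<open>a\<close>, \<^term>\<open>b\<close>, \<^term>\<open>c\<close>, the word with entries 1 there, 3 at \<^term>\<open>a + b + c\<close> and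
  2 at the square root of \<^term>\<open>a * b + b * c + c * a\<close> has Lee weight 6. Below \<^term>\<open>a = 0\<close> and \<^term>\<open>b = 1\<close>.\<close>

lemma preparata_words_six:
  assumes "odd m" "m \<ge> 2"
  obtains w where "w \<in> (preparata_words :: ('f \<Rightarrow> 4) set)" "(\<Sum>x\<in>UNIV. lee_weight (w x)) = 6"
proof -
  obtain c :: 'f where c: "c \<noteq> 0" "c \<noteq> 1" using ex_not_0_1[OF card assms(2)] by blast
  \<comment> \<open>The square root of \<open>c\<close>, since \<open>c ^ (2 ^ m) = c\<close>; for
    \<open>a = 0\<close> and \<open>b = 1\<close> the expression under the root is
    \<open>c\<close>.\<close>
  define e where "e = c ^ (2 ^ (m - 1))"
  define d where "d = 1 + c"
  have m: "Suc (m - 1) = m" using assms by simp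
  have "e ^ 2 = c ^ (2 ^ (m - 1) * 2)" by (simp add: e_def power_mult)
  also have "2 ^ (m - 1) * 2 = Suc (CARD('f) - 1)" unfolding card power_Suc2[symmetric] m by simp
  also have "c ^ \<dots> = c" by (simp only: power_Suc power_card_minus_one[OF c(1)] mult_1_right)
  finally have e2: "e ^ 2 = c" .
  have e: "e \<noteq> 0" "e \<noteq> 1" using e2 c by auto
  have "e \<noteq> c"
  proof
    assume "e = c"
    then have "c * c = c" using e2 by (simp add: power2_eq_square)
    then show False using c by simp
  qed
  have d: "d \<noteq> 0" "d \<noteq> 1" "d \<noteq> c"
    using c add_eq_0_char_two[OF two_f, of 1 c] by (auto simp: d_def)
  \<comment> \<open>Equality would give \<open>1 + c + c ^ 2 = 0\<close>, a nontrivial zero of the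
    norm form.\<close>
  have "e \<noteq> d"
  proof
    assume "e = d"
    then have "d ^ 2 = c" using e2 by simp
    moreover have "1 ^ 2 + 1 * c + c ^ 2 = d ^ 2 + c"
      by (simp add: d_def power2_eq_square algebra_simps char_two_simps[OF two_f])
    ultimately have "1 ^ 2 + 1 * c + c ^ 2 = 0" by (simp only: add_self_eq_0[OF two_f])
    then show False using norm_form_eq_0[OF card assms(1), of 1 c] by simp
  qed
  define w :: "'f \<Rightarrow> 4" where
    "w x = (if x \<in> {0, 1, c} then 1 else if x = d then 3 else if x = e then 2 else 0)" for x
  have w1: "{x. w x = 1} = {0, 1, c}" and w2: "{x. w x = 2} = {e}" and w3: "{x. w x = 3} = {d}"
    using c d e \<open>e \<noteq> c\<close> \<open>e \<noteq> d\<close> by (auto simp: w_def)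
  have 3: "card {0, 1, c} = 3" using c by auto
  have "(\<Sum>x\<in>UNIV. lee_weight (w x)) = 6" unfolding sum_lee_weight w1 w2 w3 3 by simp
  moreover have "(\<Sum>x\<in>UNIV. w x) = 0" unfolding sum_eq_0_iff_4 w1 w2 w3 3 by simp
  moreover have "(\<Sum>x\<in>UNIV. z4_map (w x) * Witt2 x 0) = (0 :: 'f witt2)"
  proof -
    have 3: "(3 :: 'f witt2) * y = - y" for y
    proof -
      have "3 * y + y = 4 * y" by (simp add: algebra_simps)
      then show ?thesis by (simp add: two_witt2(2)[OF two_f] eq_neg_iff_add_eq_0)
    qed
    have "(\<Sum>x\<in>{0, 1, c}. Witt2 x 0) = Witt2 d c"
      using c by (simp add: plus_witt2_def zero_witt2_def d_def char_two_simps[OF two_f])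
    moreover have "- Witt2 d 0 = Witt2 d (d ^ 2)"
      by (simp add: uminus_witt2_def char_two_simps[OF two_f])
    moreover have "2 * Witt2 e 0 = Witt2 0 c" by (simp add: two_times_witt2[OF two_f] e2)
    ultimately show ?thesis
      unfolding sum_four w1 w2 w3 3
      by (simp add: plus_witt2_def zero_witt2_def power2_eq_square char_two_simps[OF two_f])
  qed
  ultimately show ?thesis using that by (simp add: preparata_words_def)
qed

end

section \<open>The binary code and its parameters\<close>

context primitive_root
begin

definition points :: "'f list" where
  "points = map (\<lambda>i. \<alpha> ^ i) [0..<n] @ [0]"

lemma length_points: "length points = Suc n"
  by (simp add: points_def)

lemma distinct_points: "distinct points" and set_points: "set points = UNIV"
proof -
  have set: "set (map (\<lambda>i. \<alpha> ^ i) [0..<n]) = UNIV - {0}"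
    using powers by (simp add: lessThan_atLeast0)
  have "distinct (map (\<lambda>i. \<alpha> ^ i) [0..<n])"
    using inj_powers by (simp add: distinct_map lessThan_atLeast0)
  then show "distinct points" using set by (auto simp: points_def)
  show "set points = UNIV" unfolding points_def set_append set by auto
qed

lemma ev_Poly: "ev (Poly c) = (\<Sum>i<length c. z4_map (c ! i) * Witt2 (\<alpha> ^ i) 0)"
proof -
  have "Poly c = (\<Sum>i<length c. monom (c ! i) i)"
    by (subst poly_eq_sum_monom[of "length c" "Poly c"]) (simp_all add: nth_default_def)
  moreover have "ev (sum f A) = (\<Sum>x\<in>A. ev (f x))" for f :: "nat \<Rightarrow> 4 poly" and A
    by (induction A rule: infinite_finite_induct) auto
  ultimately show ?thesis by (simp add: teichmueller_power)
qed

lemma parity_check_words: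
  assumes h: "lift_poly h"
  shows "parity_extend ` cyclic_code n h = (\<lambda>w. map w points) ` preparata_words"
proof -
  have code: "cyclic_code n h = {c. length c = n \<and> h dvd Poly c}"
    using lift_dvd_iff[OF h] ev_monom_minus_1 by (intro cyclic_code_dvd) simp
  have iff: "map w points \<in> parity_extend ` cyclic_code n h \<longleftrightarrow> w \<in> preparata_words" for w
  proof -
    have take: "take n (map w points) = map (\<lambda>i. w (\<alpha> ^ i)) [0..<n]" by (simp add: points_def)
    have sum: "sum_list (map w points) = (\<Sum>x\<in>UNIV. w x)"
      using distinct_points set_points by (simp add: sum_list_distinct_conv_sum_set)
    have "ev (Poly (take n (map w points))) = (\<Sum>i<n. z4_map (w (\<alpha> ^ i)) * Witt2 (\<alpha> ^ i) 0)"
      unfolding take ev_Poly by simp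
    also have "\<dots> = (\<Sum>x\<in>UNIV - {0}. z4_map (w x) * Witt2 x 0)"
      unfolding powers[symmetric] by (simp add: sum.reindex[OF inj_powers])
    \<comment> \<open>The parity coordinate, at 0, is weighted by \<open>Witt2 0 0 = 0\<close>, so
      including it changes nothing.\<close>
    also have "\<dots> = (\<Sum>x\<in>UNIV. z4_map (w x) * Witt2 x 0)"
      by (rule sum.mono_neutral_left) (auto simp flip: zero_witt2_def)
    finally have ev: "ev (Poly (take n (map w points))) = (\<Sum>x\<in>UNIV. z4_map (w x) * Witt2 x 0)" .
    have len: "length (map w points) = Suc n" by (simp add: length_points)
    show ?thesis
      unfolding code parity_extend_iff[OF len] lift_dvd_iff[OF h] ev sum preparata_words_def by auto
  qed
  show ?thesis
  proof (intro equalityI subsetI)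
    fix b assume b: "b \<in> parity_extend ` cyclic_code n h"
    then have len: "length b = length points"
      by (auto simp: parity_extend_def cyclic_code_def length_points)
    \<comment> \<open>A word is read back as a function by looking up positions;
      \<open>points\<close> exhausts the field, so the lookup is always defined.\<close>
    have "b = map (the \<circ> map_of (zip points b)) points"
      using map_of_zip_nth[OF len[symmetric] distinct_points] len by (intro nth_equalityI) auto
    then show "b \<in> (\<lambda>w. map w points) ` preparata_words" using b iff by (metis imageI)
  qed (use iff in auto)
qed

lemma dual_code_eq:
  assumes "is_Z4_lift n h2 h"
  shows "dual_code (2 ^ m) (parity_extend ` cyclic_code n
    (reflect_poly (poly_quot (monom 1 n - 1) ([:-1, 1:] * h)))) = parity_extend ` cyclic_code n h"
proof -
  have h: "lift_poly h" using assms by (simp only: Z4_lift_iff)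
  obtain q where q: "[:-1, 1:] * h * q = monom 1 n - 1" "poly_quot (monom 1 n - 1) ([:-1, 1:] * h) = q"
    using ex_cofactor[OF h] by blast
  show ?thesis
    unfolding q(2) n_ge(3)[symmetric]
    by (rule dual_extended_cyclic_code[OF of_nat_n _ q(1)]) (use h n_ge in auto)
qed

lemma inj_parity_extend: "inj parity_extend"
  by (auto simp: inj_def parity_extend_def)

context
  fixes h P
  assumes h: "lift_poly h" and P: "P = gray_map ` parity_extend ` cyclic_code n h"
begin

lemma P_words: "P = (\<lambda>w. gray_map (map w points)) ` preparata_words"
  unfolding P parity_check_words[OF h] by (simp add: image_image)

lemma length_P:
  assumes "c \<in> P"
  shows "length c = 2 ^ (m + 1)"
  using assms by (auto simp: P_words length_gray_map length_points n_ge)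

lemma card_P: "card P = 2 ^ (2 ^ (m + 1) - 2 * m - 2)"
proof -
  have "card P = card (parity_extend ` cyclic_code n h)"
    unfolding P by (rule card_image, rule inj_on_subset[OF inj_on_gray_map[of "Suc n"]])
      (auto simp: parity_extend_def cyclic_code_def)
  also have "\<dots> = card (cyclic_code n h)"
    by (rule card_image, rule inj_on_subset[OF inj_parity_extend]) simp
  also have "\<dots> = (2 ^ 2) ^ (n - m)" by (simp add: card_cyclic_code[OF h])
  also have "\<dots> = 2 ^ (2 * (n - m))" by (rule power_mult[symmetric])
  also have "2 * (n - m) = 2 ^ (m + 1) - 2 * m - 2" by (simp add: n diff_mult_distrib2)
  finally show ?thesis .
qed

lemma hamming_dist_P:
  "hamming_dist (gray_map (map v points)) (gray_map (map w points)) = (\<Sum>x\<in>UNIV. lee_weight (v x - w x))"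
  by (rule hamming_dist_gray_map[OF distinct_points set_points])

lemma zero_word_P: "gray_map (map (\<lambda>_. 0) points) = replicate (2 ^ (m + 1)) 0"
  by (simp add: gray_map_def gray_beta_def gray_gamma_def map_replicate_const length_points n_ge
      flip: replicate_add)

lemma dist_P_ge:
  assumes "odd m" "c \<in> P" "d \<in> P" "c \<noteq> d"
  shows "6 \<le> hamming_dist c d"
proof (rule ccontr)
  obtain v w where vw: "v \<in> preparata_words" "w \<in> preparata_words"
      "c = gray_map (map v points)" "d = gray_map (map w points)"
    using assms by (auto simp: P_words)
  assume "\<not> 6 \<le> hamming_dist c d"
  then have "(\<Sum>x\<in>UNIV. lee_weight (v x - w x)) < 6" using vw by (simp add: hamming_dist_P)
  then have "(\<lambda>x. v x - w x) = (\<lambda>_. 0)"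
    by (rule preparata_words_small[OF card assms(1) preparata_words_diff[OF card vw(1,2)]])
  then have "v = w" by (simp add: fun_eq_iff)
  then show False using assms vw by simp
qed

lemma min_distance_P:
  assumes "odd m"
  shows "min_distance P = 6"
proof -
  let ?D = "{hamming_dist c d |c d. c \<in> P \<and> d \<in> P \<and> c \<noteq> d}"
  \<comment> \<open>Distances are bounded by the length, so \<open>Min\<close> is taken over a
    finite set.\<close>
  have bound: "?D \<subseteq> {..2 ^ (m + 1)}"
  proof
    fix y assume "y \<in> ?D"
    then obtain c d where "y = hamming_dist c d" "c \<in> P" by auto
    moreover have "hamming_dist c d \<le> card {..<length c}"
      unfolding hamming_dist_def by (rule card_mono) auto
    ultimately show "y \<in> {..2 ^ (m + 1)}" using length_P[of c] by simp
  qed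
  have ge: "6 \<le> y" if "y \<in> ?D" for y using that dist_P_ge[OF assms] by auto
  obtain w where w: "w \<in> (preparata_words :: ('f \<Rightarrow> 4) set)" "(\<Sum>x\<in>UNIV. lee_weight (w x)) = 6"
    using preparata_words_six[OF card assms m] by blast
  have dist: "hamming_dist (gray_map (map w points)) (gray_map (map (\<lambda>_. 0) points)) = 6"
    using w(2) by (simp add: hamming_dist_P)
  then have "gray_map (map w points) \<noteq> gray_map (map (\<lambda>_. 0) points)" by (auto simp: hamming_dist_def)
  moreover have "gray_map (map w points) \<in> P" "gray_map (map (\<lambda>_. 0) points) \<in> P"
    unfolding P_words using w(1) zero_preparata_words by blast+
  ultimately have six: "6 \<in> ?D" using dist by (metis (mono_tags, lifting) mem_Collect_eq)
  have "Min ?D = 6" by (rule Min_eqI[OF finite_subset[OF bound] ge six]) auto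
  then show ?thesis by (simp only: min_distance_def)
qed

lemma nearly_perfect_P:
  assumes "odd m"
  shows "nearly_perfect {..<2 ^ (m + 1)} (support ` P)"
proof (rule nearly_perfect_support)
  show "length c = 2 ^ (m + 1)" if "c \<in> P" for c using that by (rule length_P)
  show "2 ^ (m + 1) mod 3 = (1::nat)" using two_power_mod_3[OF assms] by simp
  show "replicate (2 ^ (m + 1)) 0 \<in> P"
    unfolding zero_word_P[symmetric] P_words using zero_preparata_words by blast
  show "even (hamming_weight c)" if c: "c \<in> P" for c
  proof -
    obtain w where w: "w \<in> preparata_words" "c = gray_map (map w points)" using c by (auto simp: P_words)
    have "hamming_weight c = hamming_dist c (replicate (2 ^ (m + 1)) 0)"
      by (simp add: hamming_weight_dist length_P[OF c])
    also have "\<dots> = (\<Sum>x\<in>UNIV. lee_weight (w x))"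
      unfolding zero_word_P[symmetric] w(2) hamming_dist_P by simp
    finally have "hamming_weight c = (\<Sum>x\<in>UNIV. lee_weight (w x))" .
    then show ?thesis using even_lee_weight[OF card w(1)] by simp
  qed
  show "6 \<le> hamming_dist c d" if "c \<in> P" "d \<in> P" "c \<noteq> d" for c d
    using dist_P_ge[OF assms that] .
  \<comment> \<open>Rules out truncation in the natural number subtractions of the exponent.\<close>
  have "2 * m + 2 \<le> 2 ^ (m + 1)" using n_ge by simp
  then have exponent: "(2 ^ (m + 1) - 2 * m - 2) + (2 * m + 2) = (2::nat) ^ (m + 1)" by linarith
  have "card P * (2 ^ (m + 1)) ^ 2 = 2 ^ (2 ^ (m + 1) - 2 * m - 2) * 2 ^ (2 * m + 2)"
    unfolding card_P by (simp flip: power_mult power_Suc add: mult.commute)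
  also have "\<dots> = 2 ^ 2 ^ (m + 1)" by (simp only: power_add[symmetric] exponent)
  finally show "card P * (2 ^ (m + 1)) ^ 2 = 2 ^ 2 ^ (m + 1)" .
qed

lemma weight_enumerator_P:
  assumes "odd m" "distinct fs" "set fs = (UNIV :: 'f set)"
  shows "weight_enumerator (2 ^ (m + 1)) P = weight_enumerator (2 ^ (m + 1)) (preparata_code fs)"
proof (rule weight_enumerator_eqI)
  have N: "2 * CARD('f) = 2 ^ (m + 1)" by (simp add: card)
  show "length c = 2 ^ (m + 1)" if "c \<in> P" for c using that by (rule length_P)
  show "length c = 2 ^ (m + 1)" if "c \<in> preparata_code fs" for c
    using that N by (auto simp: preparata_code_eq[OF assms(2,3)] length_pair_word[OF assms(2,3)])
  show "nearly_perfect {..<2 ^ (m + 1)} (support ` P)" using nearly_perfect_P[OF assms(1)] .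
  show "nearly_perfect {..<2 ^ (m + 1)} (support ` preparata_code fs)"
    using nearly_perfect_preparata_code[OF assms(2,3) card assms(1) m] unfolding N .
qed

end

end

theorem theorem6:
  fixes m n :: nat and h2 :: "bit poly"
  assumes "m \<ge> 2" and "n = 2 ^ m - 1"
    and "CARD('f::{field,finite}) = 2 ^ m"
    and "degree h2 = m" and "irreducible h2" and "primitive_poly TYPE('f) h2"
  shows "(\<exists>!h. is_Z4_lift n h2 h) \<and>
    (\<forall>h g D. is_Z4_lift n h2 h \<longrightarrow>
       g = reflect_poly (poly_quot (monom 1 n - 1) ([:-1, 1:] * h)) \<longrightarrow>
       D = parity_extend ` cyclic_code n g \<longrightarrow>
       parity_extend ` cyclic_code n h = dual_code (2 ^ m) D \<and>
       (odd m \<and> m \<ge> 3 \<longrightarrow>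
          (\<forall>P. P = gray_map ` dual_code (2 ^ m) D \<longrightarrow>
             (\<forall>c\<in>P. length c = 2 ^ (m + 1)) \<and>
             card P = 2 ^ (2 ^ (m + 1) - 2 * m - 2) \<and>
             min_distance P = 6 \<and>
             (\<forall>fs :: 'f list. distinct fs \<and> set fs = UNIV \<longrightarrow>
                weight_enumerator (2 ^ (m + 1)) P =
                weight_enumerator (2 ^ (m + 1)) (preparata_code fs)))))"
proof -
  obtain \<alpha> :: 'f where \<alpha>: "poly (map_poly embed_bit h2) \<alpha> = 0" "range (\<lambda>k::nat. \<alpha> ^ k) = UNIV - {0}"
    using assms(6) by (auto simp: primitive_poly_def)
  interpret primitive_root \<alpha> m n h2
    by standard (use assms \<alpha> in auto)
  show ?thesis
  proof (intro conjI allI impI)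
    show "\<exists>!h. is_Z4_lift n h2 h" by (rule ex1_Z4_lift)
    fix h g D
    assume lift: "is_Z4_lift n h2 h"
      and "g = reflect_poly (poly_quot (monom 1 n - 1) ([:-1, 1:] * h))"
      and "D = parity_extend ` cyclic_code n g"
    then have D: "dual_code (2 ^ m) D = parity_extend ` cyclic_code n h"
      using dual_code_eq[OF lift] by simp
    then show "parity_extend ` cyclic_code n h = dual_code (2 ^ m) D" by simp
    have h: "lift_poly h" using lift by (simp only: Z4_lift_iff)
    fix P assume "odd m \<and> m \<ge> 3" and "P = gray_map ` dual_code (2 ^ m) D"
    then have odd: "odd m" and P: "P = gray_map ` parity_extend ` cyclic_code n h" using D by simp_all
    show "\<forall>c\<in>P. length c = 2 ^ (m + 1)" using length_P[OF h P] by blast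
    show "card P = 2 ^ (2 ^ (m + 1) - 2 * m - 2)" by (rule card_P[OF h P])
    show "min_distance P = 6" by (rule min_distance_P[OF h P odd])
    show "weight_enumerator (2 ^ (m + 1)) P = weight_enumerator (2 ^ (m + 1)) (preparata_code fs)"
      if "distinct fs \<and> set fs = UNIV" for fs :: "'f list"
      using weight_enumerator_P[OF h P odd] that by blast
  qed
qed

end
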